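(* Let $X_1,\dots,X_N$ be i.i.d. random variables with values in a measurable space whose distribution has a parameter $\theta_\ast\in\mathbb R$; let $k=k(N)$ and $n=\lfloor N/k\rfloor$, and let $G_1,\dots,G_k$ be disjoint groups of the data with $\mathrm{card}(G_j)=n$ for $j=1,\dots,k$. Let $\bar\theta_j=\bar\theta_j(G_j)$, $j=1,\dots,k$, be the i.i.d. real-valued estimators of $\theta_\ast$ obtained by applying the same estimator to each group. Assume: (i) there is a sequence $\{\sigma_n\}_{n\in\mathbb N}$ of positive numbers such that $g(n):=\sup_{t\in\mathbb R}\Big|\mathbb P\Big(\frac{\bar\theta_1-\theta_\ast}{\sigma_n}\le t\Big)-\Phi(t)\Big|\to0$ as $n\to\infty$, where $\Phi$ is the standard normal distribution function; (ii) $k\to\infty$ and $\sqrt k\,g(n)\to0$ as $N\to\infty$; (iii) $\rho:\mathbb R\to\mathbb R$ is a convex, even function such that $\rho(z)\to\infty$ as $|z|\to\infty$ and $\|\rho'\|_\infty<\infty$, where $\rho'(x)$ is defined as the average of the right and left derivatives of $\rho$ at $x$. Let $$\widehat\theta^{(k)}_\rho:=\operatorname*{argmin}_{z\in\mathbb R}\sum_{j=1}^k\rho\Big(\frac{z-\bar\theta_j}{\sigma_n}\Big),$$ and for $z\in\mathbb R$ let $L(z):=\mathbb E\rho'(z+Z)$ with $Z\sim N(0,1)$. Then, as $N\to\infty$, $$\sqrt k\,\frac{\widehat\theta^{(k)}_\rho-\theta_\ast}{\sigma_n}\xrightarrow{d}N(0,\Delta^2),\qquad \Delta^2=\frac{\mathbb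 E\big(\rho'(Z)\big)^2}{\big(L'(0)\big)^2}.$$
   Context: $\xrightarrow{d}$ denotes convergence in distribution; $\|f\|_\infty$ is the essential supremum of $|f|$; the argmin denotes a minimizer. The partition into groups is independent of the data. *)

theory Defs
  imports "HOL-Probability.Probability"
begin

definition avg_deriv :: "(real \<Rightarrow> real) \<Rightarrow> real \<Rightarrow> real" where
  "avg_deriv f x =
     (vector_derivative f (at_left x) + vector_derivative f (at_right x)) / 2"

definition smoothed_deriv :: "(real \<Rightarrow> real) \<Rightarrow> real \<Rightarrow> real" where
  "smoothed_deriv \<rho> z = (\<integral>x. avg_deriv \<rho> (z + x) \<partial>std_normal_distribution)"

text \<open>
  An estimator is a family \<open>est\<close> in which \<open>est n\<close> acts on samples of size \<open>n\<close>, represented as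
  elements of the product space indexed by \<open>{..<n}\<close>. It is applied to a group \<open>A\<close> of data indices
  by listing the members of \<open>A\<close> in increasing order; \<open>est\<close> need not be symmetric.
\<close>

definition group_estimate ::
    "(nat \<Rightarrow> (nat \<Rightarrow> 'x) \<Rightarrow> real) \<Rightarrow> (nat \<Rightarrow> 'w \<Rightarrow> 'x) \<Rightarrow> nat set \<Rightarrow> 'w \<Rightarrow> real" where
  "group_estimate est X A \<omega> =
     est (card A) (\<lambda>i\<in>{..<card A}. X (sorted_list_of_set A ! i) \<omega>)"

text \<open>
  The function \<open>g\<close> of the normal approximation hypothesis. The estimator computed from a group of
  \<open>n\<close> i.i.d. observations with law \<open>P\<close> has the law of \<open>est n\<close> under the \<open>n\<close>-fold product of \<open>P\<close>.
\<close>

definition normal_approx_error ::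
    "'x measure \<Rightarrow> (nat \<Rightarrow> (nat \<Rightarrow> 'x) \<Rightarrow> real) \<Rightarrow> real \<Rightarrow> (nat \<Rightarrow> real) \<Rightarrow> nat \<Rightarrow> real" where
  "normal_approx_error P est \<theta> \<sigma> n =
     (SUP t. \<bar>measure (PiM {..<n} (\<lambda>_. P))
                {x \<in> space (PiM {..<n} (\<lambda>_. P)). (est n x - \<theta>) / \<sigma> n \<le> t}
              - cdf std_normal_distribution t\<bar>)"

text \<open>
  Independence of the generated sigma-algebras. The library's \<open>indep_var\<close> is not used because it
  requires both random variables to take values in the same type.
\<close>

definition indep_rv ::
    "'w measure \<Rightarrow> 'a measure \<Rightarrow> ('w \<Rightarrow> 'a) \<Rightarrow> 'b measure \<Rightarrow> ('w \<Rightarrow> 'b) \<Rightarrow> bool" where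
  "indep_rv M S X T Y \<longleftrightarrow>
     prob_space.indep_set M (sets (vimage_algebra (space M) X S))
                            (sets (vimage_algebra (space M) Y T))"

end

theory Submission
  imports Defs
begin

text \<open>
  Write \<open>\<psi>\<close> for the averaged derivative of \<open>\<rho>\<close> and \<open>Y\<^sub>j\<close> for the normalised group estimators.
  Convexity turns the event that the rescaled minimizer is at most \<open>t\<close> into a sign condition on
  \<open>\<Sum>\<^sub>j \<psi> (Y\<^sub>j - t / sqrt k)\<close>, up to boundary events that vanish in the limit. This is a row sum of
  bounded i.i.d. variables. As \<open>\<psi>\<close> is monotone and bounded, replacing the law of \<open>Y\<^sub>j\<close> by the normal
  law changes the characteristic function of one summand at frequency \<open>s / sqrt k\<close> by
  \<open>O(g / sqrt k)\<close>, hence that of the whole row by \<open>O(sqrt k g)\<close>, which tends to zero. For normal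
  \<open>Y\<^sub>j\<close>, a second order expansion gives a normal limit of the normalised row sum with mean
  \<open>- t L'(0)\<close> and variance \<open>E (\<psi>(Z))\<^sup>2\<close>.
\<close>

section \<open>Derivatives of even convex functions\<close>

text \<open>An error of order g in each of the k summands would add up to k g, which the hypotheses
  do not control. The missing factor 1 / sqrt k comes from integration by parts: for laws carried by
  [-C, C], the characteristic functions at frequency u differ by at most 2 C |u| times the uniform
  distance of the distribution functions, and here u has order 1 / sqrt k. The score \<psi> may
  jump, so L cannot be differentiated through \<psi>. Moving the shift onto the Gaussian density
  gives L'(0) = E (Z \<psi>(Z)), and coercivity makes this positive. A minimizer need not be unique
  and the score sum may vanish with positive probability, so minimizer and score are linked only by
  one-sided implications. The gap closes because the normal distribution function is continuous.
  Finally, the estimators depend on the random groups as well as on the data. Given the partition,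
  their joint law is the same product for each of its values, so averaging over the partition
  changes nothing.\<close>

lemma convex_on_slope_mono:
  fixes f :: "real \<Rightarrow> real"
  assumes f: "convex_on UNIV f" and "y \<le> z" "y \<noteq> x" "z \<noteq> x"
  shows "(f y - f x) / (y - x) \<le> (f z - f x) / (z - x)"
proof (cases "y = z")
  case False
  with assms have "y < z" by simp
  have swap: "(f a - f b) / (a - b) = (f b - f a) / (b - a)" for a b
    by (metis minus_diff_eq minus_divide_divide)
  consider "x < y" | "y < x" "x < z" | "z < x"
    using assms by linarith
  then show ?thesis
  proof cases
    case 1
    from convex_on_slope_le(1)[OF f, of x z y] 1 \<open>y < z\<close> show ?thesis
      by (simp add: swap[of x])
  next
    case 2
    from convex_on_slope_le[OF f, of y z x] 2 \<open>y < z\<close> show ?thesis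
      by (simp add: swap[of x])
  next
    case 3
    from convex_on_slope_le(2)[OF f, of y x z] 3 \<open>y < z\<close> show ?thesis
      by simp
  qed
qed auto

text \<open>Right slopes decrease as the second point approaches \<open>x\<close> and stay above
  every left slope, for instance the one to \<open>x - 1\<close>. Their infimum is therefore finite
  and is the right derivative. As it separates left slopes from right slopes, it also gives a global
  supporting line.\<close>

lemma convex_has_right_derivative:
  fixes f :: "real \<Rightarrow> real"
  assumes f: "convex_on UNIV f"
  obtains D where "(f has_vector_derivative D) (at_right x)" "\<And>y. f x + D * (y - x) \<le> f y"
proof -
  let ?q = "\<lambda>y. (f y - f x) / (y - x)"
  have bnd: "?q z \<le> ?q y" if "x < y" "z < x" for y z
    using convex_on_slope_mono[OF f, of z y x] that by simp
  define D where "D = Inf (?q ` ({x<..} \<inter> UNIV))"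
  have "(?q \<longlongrightarrow> D) (at x within ({x<..} \<inter> UNIV))"
    unfolding D_def
    by (intro Lim_right_bound[where K="?q (x - 1)"] convex_on_slope_mono[OF f] bnd) simp_all
  then have lim: "(?q \<longlongrightarrow> D) (at_right x)" by simp
  have upper: "D \<le> ?q y" if "x < y" for y
    unfolding D_def using that bnd[of _ "x - 1"]
    by (intro cInf_lower bdd_belowI[of _ "?q (x - 1)"]) auto
  have lower: "?q z \<le> D" if "z < x" for z
    unfolding D_def using that bnd by (intro cInf_greatest) (auto intro: exI[of _ "x + 1"])
  show ?thesis
  proof
    show "(f has_vector_derivative D) (at_right x)"
      using lim by (simp add: has_field_derivative_iff flip: has_real_derivative_iff_has_vector_derivative)
    show "f x + D * (y - x) \<le> f y" for y
      using upper[of y] lower[of y] by (cases x y rule: linorder_cases) (auto simp: field_simps)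
  qed
qed

text \<open>For an even function this turns right derivatives into left ones, so only right
  derivatives need to be constructed.\<close>

lemma has_vector_derivative_reflect:
  fixes f :: "real \<Rightarrow> real"
  assumes "(f has_vector_derivative D) (at_right (- x))"
  shows "((\<lambda>y. f (- y)) has_vector_derivative - D) (at_left x)"
proof -
  have "uminus ` {..<x} = {- x<..}"
    by (auto simp: image_iff intro: bexI[of _ "- y" for y])
  then have "((f \<circ> uminus) has_vector_derivative (- 1) *\<^sub>R D) (at_left x)"
    using assms by (intro vector_diff_chain_within) (auto intro!: derivative_eq_intros)
  then show ?thesis by (simp add: o_def)
qed

section \<open>The averaged derivative as an odd, monotone subgradient\<close>

context
  fixes f :: "real \<Rightarrow> real"
  assumes convex: "convex_on UNIV f" and even: "\<And>z. f (- z) = f z"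
begin

lemma vector_derivative_right_convex:
  "(f has_vector_derivative vector_derivative f (at_right x)) (at_right x)"
  "f x + vector_derivative f (at_right x) * (y - x) \<le> f y"
proof -
  obtain D where D: "(f has_vector_derivative D) (at_right x)" "\<And>y. f x + D * (y - x) \<le> f y"
    using convex_has_right_derivative[OF convex] by blast
  then have "vector_derivative f (at_right x) = D"
    by (intro vector_derivative_within) auto
  with D show "(f has_vector_derivative vector_derivative f (at_right x)) (at_right x)"
    "f x + vector_derivative f (at_right x) * (y - x) \<le> f y"
    by auto
qed

lemma avg_deriv_even_convex:
  "avg_deriv f x = (vector_derivative f (at_right x) - vector_derivative f (at_right (- x))) / 2"
proof -
  have "vector_derivative f (at_left x) = - vector_derivative f (at_right (- x))"
    using has_vector_derivative_reflect[OF vector_derivative_right_convex(1), of x]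
    by (intro vector_derivative_within) (auto simp: even)
  then show ?thesis by (simp add: avg_deriv_def)
qed

lemma avg_deriv_odd: "avg_deriv f (- x) = - avg_deriv f x"
  by (simp add: avg_deriv_even_convex field_simps)

text \<open>The average of two supporting lines: the one at \<open>x\<close> and the mirror image of
  the one at \<open>- x\<close>.\<close>

lemma avg_deriv_subgradient: "f x + avg_deriv f x * (y - x) \<le> f y"
  using vector_derivative_right_convex(2)[of x y] vector_derivative_right_convex(2)[of "- x" "- y"]
  by (simp add: avg_deriv_even_convex even field_simps)

lemma mono_avg_deriv: "mono (avg_deriv f)"
proof (rule monoI)
  fix x y :: real assume "x \<le> y"
  moreover have "0 \<le> (avg_deriv f y - avg_deriv f x) * (y - x)"
    using avg_deriv_subgradient[of x y] avg_deriv_subgradient[of y x] by (simp add: algebra_simps)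
  ultimately show "avg_deriv f x \<le> avg_deriv f y"
    by (cases "x = y") (auto simp: zero_le_mult_iff)
qed

text \<open>An essential bound becomes a bound everywhere. A unit interval is not a null set, so to
  the right of any point the bound holds somewhere; monotonicity carries it back as an upper bound,
  and oddness supplies the lower one.\<close>

lemma avg_deriv_bounded:
  assumes "esssup lborel (\<lambda>x. ereal \<bar>avg_deriv f x\<bar>) < \<infinity>"
  obtains C where "\<And>x. \<bar>avg_deriv f x\<bar> \<le> C"
proof -
  obtain C where C: "esssup lborel (\<lambda>x. ereal \<bar>avg_deriv f x\<bar>) \<le> ereal C"
    using assms by (cases "esssup lborel (\<lambda>x. ereal \<bar>avg_deriv f x\<bar>)") auto
  have "AE x in lborel. ereal \<bar>avg_deriv f x\<bar> \<le> ereal C"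
    using esssup_AE[of "\<lambda>x. ereal \<bar>avg_deriv f x\<bar>" lborel] by eventually_elim (use C in order)
  then have AE: "AE x in lborel. \<bar>avg_deriv f x\<bar> \<le> C" by simp
  have large: "\<exists>y\<ge>x. \<bar>avg_deriv f y\<bar> \<le> C" for x
  proof (rule ccontr)
    assume "\<not> ?thesis"
    with AE have "AE y in lborel. y \<notin> {x..x+1}" by (auto elim!: eventually_mono)
    then have "{x..x+1} \<in> null_sets lborel"
      by (simp add: AE_iff_null_sets)
    then show False by auto
  qed
  have "avg_deriv f x \<le> C" for x
  proof -
    obtain y where "y \<ge> x" "\<bar>avg_deriv f y\<bar> \<le> C" using large by blast
    then show ?thesis using monoD[OF mono_avg_deriv, of x y] by linarith
  qed
  from this[of x for x] this[of "- x" for x] show ?thesis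
    by (intro that[of C]) (auto simp: avg_deriv_odd abs_le_iff)
qed

text \<open>The subgradient inequality at \<open>x\<close>, tested at 0, gives
  \<open>avg_deriv f x * x \<ge> f x - f 0\<close>, which is positive for large \<open>x\<close> by
  coercivity. This is what later keeps the constants of the limit law away from 0.\<close>

lemma avg_deriv_eventually_pos:
  assumes "filterlim f at_top at_infinity"
  obtains a where "\<And>x. x \<ge> a \<Longrightarrow> avg_deriv f x > 0"
proof -
  have "\<forall>\<^sub>F x in at_infinity. f x > f 0"
    using assms by (simp add: filterlim_at_top_dense)
  then obtain b where b: "\<And>x. \<bar>x\<bar> \<ge> b \<Longrightarrow> f x > f 0"
    by (auto simp: eventually_at_infinity)
  show ?thesis
  proof
    fix x assume "x \<ge> max 1 b"
    then have "avg_deriv f x * x > 0"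
      using avg_deriv_subgradient[of x 0] b[of x] by simp
    with \<open>x \<ge> max 1 b\<close> show "avg_deriv f x > 0"
      by (simp add: zero_less_mult_iff)
  qed
qed

end

text \<open>Both parts are the subgradient inequality at \<open>w\<close>, tested at the minimizer.\<close>

lemma arg_min_score_bounds:
  fixes f :: "real \<Rightarrow> real" and y :: "'i \<Rightarrow> real"
  assumes convex: "convex_on UNIV f" and even: "\<And>z. f (- z) = f z" and "s > 0"
    and min: "is_arg_min (\<lambda>z. \<Sum>j\<in>J. f ((z - y j) / s)) (\<lambda>_. True) m"
  shows "(\<Sum>j\<in>J. avg_deriv f ((y j - w) / s)) < 0 \<Longrightarrow> m \<le> w"
    and "m < w \<Longrightarrow> (\<Sum>j\<in>J. avg_deriv f ((y j - w) / s)) \<le> 0"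
proof -
  let ?S = "\<Sum>j\<in>J. avg_deriv f ((y j - w) / s)"
  have "f ((w - y j) / s) + avg_deriv f ((y j - w) / s) * ((w - m) / s) \<le> f ((m - y j) / s)" for j
  proof -
    \<comment> \<open>The loss is evaluated at \<open>(w - y j) / s\<close>, the score at the
      opposite point; evenness reconciles the two.\<close>
    have "- ((y j - w) / s) = (w - y j) / s" "- ((y j - m) / s) = (m - y j) / s"
      "(y j - m) / s - (y j - w) / s = (w - m) / s"
      using \<open>s > 0\<close> by (simp_all add: field_simps)
    then show ?thesis
      using avg_deriv_subgradient[OF convex even, of "(y j - w) / s" "(y j - m) / s"]
        even[of "(y j - w) / s"] even[of "(y j - m) / s"] by simp
  qed
  then have "(\<Sum>j\<in>J. f ((w - y j) / s) + avg_deriv f ((y j - w) / s) * ((w - m) / s))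
      \<le> (\<Sum>j\<in>J. f ((m - y j) / s))"
    by (rule sum_mono)
  moreover have "(\<Sum>j\<in>J. f ((m - y j) / s)) \<le> (\<Sum>j\<in>J. f ((w - y j) / s))"
    using min by (auto simp: is_arg_min_linorder)
  \<comment> \<open>A nonzero \<open>?S\<close> fixes the side of \<open>w\<close> on which
    \<open>m\<close> lies. If \<open>?S = 0\<close>, minimizers on either side are possible, hence a
    strict premise in both conclusions.\<close>
  ultimately have "?S * ((w - m) / s) \<le> 0"
    by (simp only: sum.distrib sum_distrib_right)
  then show "?S < 0 \<Longrightarrow> m \<le> w" and "m < w \<Longrightarrow> ?S \<le> 0"
    using \<open>s > 0\<close> by (auto simp: mult_le_0_iff zero_le_divide_iff divide_le_0_iff)
qed

section \<open>Characteristic functions and distribution functions\<close>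

text \<open>Integration by parts through Fubini: for x in [-C, C],
  \<open>iexp (s * C) - iexp (s * x)\<close> is the integral of the derivative over [x, C], and
  exchanging the integrals turns the indicator of x \<le> u into the distribution function at
  u.\<close>

lemma char_eq_cdf_integral:
  assumes "real_distribution \<mu>" and AE: "AE x in \<mu>. \<bar>x\<bar> \<le> C"
  shows "char \<mu> s = iexp (s * C) -
    (CLINT u|lborel. indicator {-C..C} u *\<^sub>R (\<i> * s * iexp (s * u) * cdf \<mu> u))"
proof -
  interpret \<mu>: real_distribution \<mu> by fact
  interpret pair_sigma_finite \<mu> lborel by standard
  let ?f = "\<lambda>x u::real. indicator {-C..C} u *\<^sub>R (indicator {x..} u *\<^sub>R (\<i> * s * iexp (s * u)))"
  have int: "integrable (\<mu> \<Otimes>\<^sub>M lborel) (\<lambda>(x, u). ?f x u)"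
  proof (rule Bochner_Integration.integrable_bound)
    \<comment> \<open>The strip over [-C, C] has measure 2 C, because the other factor is a
      probability measure; the integrand is at most |s| on it.\<close>
    show "integrable (\<mu> \<Otimes>\<^sub>M lborel) (\<lambda>p. indicat_real (UNIV \<times> {-C..C}) p * \<bar>s\<bar>)"
      by (intro integrable_mult_left integrable_real_indicator)
         (auto simp: emeasure_lborel_Icc_eq lborel.emeasure_pair_measure_Times ennreal_mult_less_top \<mu>.emeasure_space_1[simplified])
    have [measurable]: "{p. fst p \<le> (snd p::real)} \<in> sets (\<mu> \<Otimes>\<^sub>M lborel)"
    proof -
      have "{p \<in> space (borel \<Otimes>\<^sub>M borel). fst p \<le> (snd p::real)} \<in> sets (borel \<Otimes>\<^sub>M borel)"
        by measurable
      then show ?thesis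
        by (simp add: sets_pair_measure_cong[OF \<mu>.events_eq_borel sets_lborel] space_pair_measure)
    qed
    have "(\<lambda>(x, u). ?f x u) =
        (\<lambda>p. indicator {-C..C} (snd p) *\<^sub>R (indicator {p. fst p \<le> snd p} p *\<^sub>R (\<i> * s * iexp (s * snd p))))"
      by (auto simp: fun_eq_iff split: split_indicator)
    also have "\<dots> \<in> borel_measurable (\<mu> \<Otimes>\<^sub>M lborel)"
      by measurable
    finally show "(\<lambda>(x, u). ?f x u) \<in> borel_measurable (\<mu> \<Otimes>\<^sub>M lborel)" .
    show "AE p in \<mu> \<Otimes>\<^sub>M lborel. norm (case p of (x, u) \<Rightarrow> ?f x u) \<le> norm (indicat_real (UNIV \<times> {-C..C}) p * \<bar>s\<bar>)"
      by (intro AE_I2) (auto simp: norm_mult indicator_def)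
  qed
  have inner: "(CLINT u|lborel. ?f x u) = iexp (s * C) - iexp (s * x)" if x: "\<bar>x\<bar> \<le> C" for x
  proof -
    have "(CLINT u|lborel. ?f x u) = (CLINT u|lborel. indicator {x..C} u *\<^sub>R (\<i> * s * iexp (s * u)))"
      using x by (intro Bochner_Integration.integral_cong) (auto split: split_indicator)
    also have "\<dots> = iexp (s * C) - iexp (s * x)"
      using x by (intro integral_FTC_atLeastAtMost)
        (auto intro!: derivative_eq_intros continuous_intros has_vector_derivative_real_field
          simp: has_real_derivative_iff_has_vector_derivative)
    finally show ?thesis .
  qed
  have "(CLINT u|lborel. indicator {-C..C} u *\<^sub>R (\<i> * s * iexp (s * u) * cdf \<mu> u)) =
      (CLINT u|lborel. CLINT x|\<mu>. ?f x u)"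
  proof (intro Bochner_Integration.integral_cong refl)
    fix u :: real
    have "(CLINT x|\<mu>. ?f x u) =
        (CLINT x|\<mu>. indicator {..u} x *\<^sub>R (indicator {-C..C} u *\<^sub>R (\<i> * s * iexp (s * u))))"
      by (intro Bochner_Integration.integral_cong) (simp_all add: indicator_def)
    also have "\<dots> = measure \<mu> {..u} *\<^sub>R (indicator {-C..C} u *\<^sub>R (\<i> * s * iexp (s * u)))"
      by (subst integral_scaleR_left) (auto simp: \<mu>.emeasure_eq_measure)
    finally have "(CLINT x|\<mu>. ?f x u) = cdf \<mu> u *\<^sub>R (indicator {-C..C} u *\<^sub>R (\<i> * s * iexp (s * u)))"
      by (simp only: cdf_def)
    then show "indicator {-C..C} u *\<^sub>R (\<i> * s * iexp (s * u) * cdf \<mu> u) = (CLINT x|\<mu>. ?f x u)"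
      by (simp only: scaleR_conv_of_real mult_ac)
  qed
  also have "\<dots> = (CLINT x|\<mu>. CLINT u|lborel. ?f x u)"
    using int by (rule Fubini_integral)
  also have "\<dots> = (CLINT x|\<mu>. iexp (s * C) - iexp (s * x))"
  proof (rule integral_cong_AE)
    show "(\<lambda>x. CLINT u|lborel. ?f x u) \<in> borel_measurable \<mu>"
      by (rule lborel.borel_measurable_lebesgue_integral[OF borel_measurable_integrable[OF int]])
    show "AE x in \<mu>. (CLINT u|lborel. ?f x u) = iexp (s * C) - iexp (s * x)"
      using AE by eventually_elim (rule inner)
  qed simp
  also have "\<dots> = iexp (s * C) - char \<mu> s"
    unfolding char_def by (subst Bochner_Integration.integral_diff) (auto simp: \<mu>.prob_space[simplified] intro!: \<mu>.integrable_iexp)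
  finally show ?thesis by simp
qed

text \<open>The boundary terms \<open>iexp (s * C)\<close> cancel, and what remains is an integrand
  of size at most |s| g over an interval of length 2 C. The factor |s| is essential: it supplies the
  1 / sqrt k for small frequencies.\<close>

lemma norm_char_diff_le:
  assumes "real_distribution \<mu>" "AE x in \<mu>. \<bar>x\<bar> \<le> C"
    and "real_distribution \<nu>" "AE x in \<nu>. \<bar>x\<bar> \<le> C"
    and C: "C \<ge> 0" and g: "\<And>u. \<bar>cdf \<mu> u - cdf \<nu> u\<bar> \<le> g"
  shows "cmod (char \<mu> s - char \<nu> s) \<le> 2 * C * \<bar>s\<bar> * g"
proof -
  interpret \<mu>: real_distribution \<mu> by fact
  interpret \<nu>: real_distribution \<nu> by fact
  let ?k = "\<lambda>F u. indicator {-C..C} u *\<^sub>R (\<i> * s * iexp (s * u) * complex_of_real (F u))"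
  have meas: "cdf m \<in> borel_measurable borel" if "real_distribution m" for m
  proof -
    interpret m: real_distribution m by fact
    show ?thesis
      by (intro borel_measurable_mono monoI m.cdf_nondecreasing)
  qed
  note [measurable] = meas[OF assms(1)] meas[OF assms(3)]
  have dom: "integrable lborel (\<lambda>u. indicat_real {-C..C} u * b)" for b
    by (intro integrable_mult_left integrable_real_indicator) (auto simp: emeasure_lborel_Icc_eq)
  have int: "integrable lborel (?k (cdf m))" if "real_distribution m" "m = \<mu> \<or> m = \<nu>" for m
  proof (rule Bochner_Integration.integrable_bound[OF dom[of "\<bar>s\<bar>"]])
    interpret m: real_distribution m by fact
    show "?k (cdf m) \<in> borel_measurable lborel"
      using that(2) by auto
    show "AE u in lborel. norm (?k (cdf m) u) \<le> norm (indicat_real {-C..C} u * \<bar>s\<bar>)"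
      by (intro AE_I2) (auto simp: norm_mult m.cdf_nonneg m.cdf_bounded_prob mult_left_le split: split_indicator)
  qed
  have "char \<nu> s - char \<mu> s =
      (CLINT u|lborel. ?k (cdf \<mu>) u) - (CLINT u|lborel. ?k (cdf \<nu>) u)"
    unfolding char_eq_cdf_integral[OF assms(1,2)] char_eq_cdf_integral[OF assms(3,4)] by simp
  also have "\<dots> = (CLINT u|lborel. ?k (cdf \<mu>) u - ?k (cdf \<nu>) u)"
    using int assms(1,3) by (intro Bochner_Integration.integral_diff[symmetric]) auto
  also have "\<dots> = (CLINT u|lborel. ?k (\<lambda>u. cdf \<mu> u - cdf \<nu> u) u)"
    by (intro Bochner_Integration.integral_cong) (auto simp: algebra_simps)
  finally have "cmod (char \<mu> s - char \<nu> s) =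
      cmod (CLINT u|lborel. ?k (\<lambda>u. cdf \<mu> u - cdf \<nu> u) u)"
    by (metis norm_minus_commute)
  also have "\<dots> \<le> (LINT u|lborel. norm (?k (\<lambda>u. cdf \<mu> u - cdf \<nu> u) u))"
    by (rule integral_norm_bound)
  also have "\<dots> \<le> (LINT u|lborel. indicat_real {-C..C} u * (\<bar>s\<bar> * g))"
    using g by (intro integral_mono' dom)
      (auto simp: norm_mult simp flip: of_real_diff intro!: mult_left_mono mult_nonneg_nonneg order_trans[OF abs_ge_zero g] split: split_indicator)
  also have "\<dots> = 2 * C * \<bar>s\<bar> * g"
    using C by simp
  finally show ?thesis .
qed

text \<open>The comparison is with exp (w / k), whose k-th power is exp w. Both bases lie in the
  closed unit disc, the second because \<open>Re w \<le> 0\<close>, so the powers differ by at most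
  k times the difference of the bases. This tends to 0 since k (exp (w / k) - 1) tends to w; no
  complex logarithm enters.\<close>

lemma tendsto_one_plus_power_exp:
  fixes z :: "nat \<Rightarrow> complex" and k :: "nat \<Rightarrow> nat"
  assumes k: "filterlim k at_top sequentially"
    and lim: "(\<lambda>N. of_nat (k N) * z N) \<longlonglongrightarrow> w"
    and le: "\<And>N. norm (1 + z N) \<le> 1" and "Re w \<le> 0"
  shows "(\<lambda>N. (1 + z N) ^ k N) \<longlonglongrightarrow> exp w"
proof -
  let ?e = "\<lambda>N. exp (w / of_nat (k N))"
  have pos: "\<forall>\<^sub>F N in sequentially. k N > 0"
    using eventually_compose_filterlim[OF eventually_gt_at_top k] .
  have r: "filterlim (\<lambda>N. complex_of_real (1 / real (k N))) (at 0) sequentially"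
  proof (rule filterlim_atI)
    have "(\<lambda>N. 1 / real (k N)) \<longlonglongrightarrow> 0"
      by (rule tendsto_divide_0[OF tendsto_const filterlim_at_top_imp_at_infinity])
         (rule filterlim_compose[OF filterlim_real_sequentially k])
    then show "(\<lambda>N. complex_of_real (1 / real (k N))) \<longlonglongrightarrow> 0"
      by (rule tendsto_of_real[where 'a=complex, of _ 0, simplified of_real_0])
    show "\<forall>\<^sub>F N in sequentially. complex_of_real (1 / real (k N)) \<noteq> 0"
      using pos by eventually_elim auto
  qed
  have "((\<lambda>h. exp (h * w)) has_field_derivative w) (at 0)"
    by (auto intro!: derivative_eq_intros)
  then have "((\<lambda>h. (exp (h * w) - 1) / h) \<longlongrightarrow> w) (at 0)"
    by (simp add: has_field_derivative_iff)
  from filterlim_compose[OF this r]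
  have e: "(\<lambda>N. of_nat (k N) * (?e N - 1)) \<longlonglongrightarrow> w"
    by (simp add: mult_ac)
  have "(\<lambda>N. norm (of_nat (k N) * z N - of_nat (k N) * (?e N - 1))) \<longlonglongrightarrow> norm (w - w)"
    by (intro tendsto_intros lim e)
  then have lim0: "(\<lambda>N. norm (of_nat (k N) * z N - of_nat (k N) * (?e N - 1))) \<longlonglongrightarrow> 0"
    by simp
  have diff: "norm ((1 + z N) ^ k N - ?e N ^ k N) \<le>
      norm (of_nat (k N) * z N - of_nat (k N) * (?e N - 1))" for N
  proof -
    have "norm (?e N) \<le> 1"
      using \<open>Re w \<le> 0\<close> by (simp add: Re_divide_of_nat divide_le_0_iff)
    from norm_power_diff[OF le[of N] this, of "k N"]
    have "norm ((1 + z N) ^ k N - ?e N ^ k N) \<le> norm (of_nat (k N) * (1 + z N - ?e N))"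
      by (simp add: norm_mult)
    then show ?thesis by (simp add: algebra_simps)
  qed
  have "(\<lambda>N. (1 + z N) ^ k N - ?e N ^ k N) \<longlonglongrightarrow> 0"
    by (rule Lim_null_comparison[OF always_eventually[OF allI] lim0]) (rule diff)
  moreover have "\<forall>\<^sub>F N in sequentially. (1 + z N) ^ k N - ?e N ^ k N = (1 + z N) ^ k N - exp w"
    using pos by eventually_elim (simp flip: exp_of_nat_mult)
  ultimately have "(\<lambda>N. (1 + z N) ^ k N - exp w) \<longlonglongrightarrow> 0"
    by (rule Lim_transform_eventually)
  then show ?thesis by (rule LIM_zero_cancel)
qed

text \<open>Such a set is empty, the whole line, or a closed or open half-line. Open half-lines do
  occur as preimages of closed ones under a monotone function with jumps.\<close>

lemma abs_measure_diff_down_closed_le: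
  fixes S :: "real set"
  assumes "real_distribution \<mu>" "real_distribution \<nu>"
    and g: "\<And>u. \<bar>cdf \<mu> u - cdf \<nu> u\<bar> \<le> g"
    and down: "\<And>x y. x \<in> S \<Longrightarrow> y \<le> x \<Longrightarrow> y \<in> S"
  shows "\<bar>measure \<mu> S - measure \<nu> S\<bar> \<le> g"
proof -
  interpret \<mu>: real_distribution \<mu> by fact
  interpret \<nu>: real_distribution \<nu> by fact
  have g0: "g \<ge> 0" using g[of 0] by linarith
  consider "S = {}" | "S = UNIV" | "S \<noteq> {}" "bdd_above S"
    using down by (metis UNIV_eq_I bdd_above.I linear)
  then show ?thesis
  proof cases
    case 3
    define a where "a = Sup S"
    have le: "x \<le> a" if "x \<in> S" for x
      unfolding a_def using that 3 by (intro cSup_upper)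
    have less: "x \<in> S" if "x < a" for x
      using that 3 down less_cSup_iff[of S x] unfolding a_def by (meson less_imp_le)
    consider "S = {..a}" | "S = {..<a}"
    proof (cases "a \<in> S")
      case True
      with le less have "S = {..a}" by (auto simp: le_less)
      then show ?thesis by (rule that)
    next
      case False
      with le less have "S = {..<a}" by (force simp: less_le)
      then show ?thesis by (rule that)
    qed
    then show ?thesis
    proof cases
      case 1
      then show ?thesis using g[of a] by (simp add: cdf_def)
    next
      case 2
      \<comment> \<open>The measure of an open half-line is the left limit of the distribution
        function, so the bound passes to the limit.\<close>
      have "((\<lambda>u. \<bar>cdf \<mu> u - cdf \<nu> u\<bar>) \<longlongrightarrow> \<bar>measure \<mu> {..<a} - measure \<nu> {..<a}\<bar>) (at_left a)"
        by (intro tendsto_intros \<mu>.cdf_at_left \<nu>.cdf_at_left)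
      then show ?thesis
        unfolding 2 by (rule tendsto_upperbound) (use g in auto)
    qed
  qed (use g0 \<mu>.prob_space \<nu>.prob_space in auto)
qed

text \<open>Preimages of half-lines under a monotone map are closed downwards, so the uniform
  distance of distribution functions does not grow under \<open>f\<close>, whether or not
  \<open>f\<close> is continuous; boundedness confines the images to [-C, C].\<close>

lemma norm_char_mono_image_diff_le:
  assumes \<mu>: "real_distribution \<mu>" and \<nu>: "real_distribution \<nu>"
    and g: "\<And>u. \<bar>cdf \<mu> u - cdf \<nu> u\<bar> \<le> g"
    and f: "mono f" and bnd: "\<And>x. \<bar>f x\<bar> \<le> C"
  shows "cmod (char (distr \<mu> borel f) s - char (distr \<nu> borel f) s) \<le> 2 * C * \<bar>s\<bar> * g"
proof -
  interpret \<mu>: real_distribution \<mu> by fact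
  interpret \<nu>: real_distribution \<nu> by fact
  have [measurable]: "f \<in> borel_measurable borel"
    using f by (rule borel_measurable_mono)
  show ?thesis
  proof (rule norm_char_diff_le)
    show "C \<ge> 0" using bnd[of 0] by linarith
    show "\<bar>cdf (distr \<mu> borel f) u - cdf (distr \<nu> borel f) u\<bar> \<le> g" for u
      using abs_measure_diff_down_closed_le[OF \<mu> \<nu> g, of "f -` {..u}"] monoD[OF f]
      by (auto simp: cdf_def measure_distr intro: order_trans)
  qed (auto simp: AE_distr_iff bnd)
qed

lemma norm_char_second_order_le:
  assumes "real_distribution \<mu>" and AE: "AE x in \<mu>. \<bar>x\<bar> \<le> C"
  shows "cmod (char \<mu> t - (1 + \<i> * t * (LINT x|\<mu>. x) - t\<^sup>2 * (LINT x|\<mu>. x\<^sup>2) / 2)) \<le> \<bar>t\<bar> ^ 3 * C ^ 3 / 6"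
proof -
  interpret \<mu>: real_distribution \<mu> by fact
  have bound: "AE x in \<mu>. \<bar>x\<bar> ^ m \<le> C ^ m" for m
    using AE by eventually_elim (auto intro: power_mono)
  have int: "integrable \<mu> (\<lambda>x. x ^ m)" for m
    using bound[of m] by (intro \<mu>.integrable_const_bound[where B="C ^ m"]) (auto simp: power_abs)
  have "cmod (char \<mu> t - (\<Sum>k\<le>2. ((\<i> * t) ^ k / fact k) * \<mu>.expectation (\<lambda>x. x ^ k))) \<le>
      \<bar>t\<bar>\<^sup>2 / fact (Suc 2) * \<mu>.expectation (\<lambda>x. min (2 * \<bar>x\<bar>\<^sup>2 * real (Suc 2)) (\<bar>t\<bar> * \<bar>x\<bar> ^ Suc 2))"
    by (rule \<mu>.char_approx2) (rule int)
  \<comment> \<open>The minimum is bounded by its cubic branch, which gives C ^ 3 and, with the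
    factorial, the constant 6. The quadratic branch, at most 6 x^2, serves only for
    integrability.\<close>
  also have "\<dots> \<le> \<bar>t\<bar>\<^sup>2 / fact (Suc 2) * (\<bar>t\<bar> * C ^ 3)"
  proof (intro mult_left_mono)
    have "\<mu>.expectation (\<lambda>x. min (2 * \<bar>x\<bar>\<^sup>2 * real (Suc 2)) (\<bar>t\<bar> * \<bar>x\<bar> ^ Suc 2)) \<le> \<mu>.expectation (\<lambda>x. \<bar>t\<bar> * C ^ 3)"
    proof (intro integral_mono_AE)
      show "AE x in \<mu>. min (2 * \<bar>x\<bar>\<^sup>2 * real (Suc 2)) (\<bar>t\<bar> * \<bar>x\<bar> ^ Suc 2) \<le> \<bar>t\<bar> * C ^ 3"
        using bound[of 3] by eventually_elim (auto simp: numeral_3_eq_3 min_le_iff_disj intro!: mult_left_mono)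
      show "integrable \<mu> (\<lambda>x. min (2 * \<bar>x\<bar>\<^sup>2 * real (Suc 2)) (\<bar>t\<bar> * \<bar>x\<bar> ^ Suc 2))"
        using int[of 2] by (rule Bochner_Integration.integrable_bound[OF integrable_mult_right[of 6]]) auto
    qed simp
    then show "\<mu>.expectation (\<lambda>x. min (2 * \<bar>x\<bar>\<^sup>2 * real (Suc 2)) (\<bar>t\<bar> * \<bar>x\<bar> ^ Suc 2)) \<le> \<bar>t\<bar> * C ^ 3"
      by (simp add: \<mu>.prob_space[simplified])
  qed simp
  also have "\<dots> = \<bar>t\<bar> ^ 3 * C ^ 3 / 6"
    by (simp add: eval_nat_numeral)
  also have "(\<Sum>k\<le>2. ((\<i> * t) ^ k / fact k) * \<mu>.expectation (\<lambda>x. x ^ k)) =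
      1 + \<i> * t * (LINT x|\<mu>. x) - t\<^sup>2 * (LINT x|\<mu>. x\<^sup>2) / 2"
    by (simp add: eval_nat_numeral \<mu>.prob_space[simplified] field_simps)
  finally show ?thesis .
qed

section \<open>Shifts of the standard normal distribution\<close>

lemma abs_exp_diff_one_le: "\<bar>exp y - 1\<bar> \<le> \<bar>y\<bar> * exp \<bar>y\<bar>" for y :: real
proof (cases "y \<ge> 0")
  case True
  have "(1 - y) * exp y \<le> exp (- y) * exp y"
    using exp_ge_add_one_self[of "- y"] by (intro mult_right_mono) auto
  then show ?thesis using True by (simp add: algebra_simps flip: exp_add)
next
  case False
  then have "\<bar>exp y - 1\<bar> \<le> \<bar>y\<bar> * 1"
    using exp_ge_add_one_self[of y] by (simp add: exp_le_one_iff abs_if del: exp_ge_add_one_self)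
  also have "\<dots> \<le> \<bar>y\<bar> * exp \<bar>y\<bar>" by (intro mult_left_mono) auto
  finally show ?thesis .
qed

text \<open>Completing the square: an exponential tilt of the standard normal density is, up to a
  constant, the normal density with mean \<open>z\<close>. Hence all exponential moments are
  finite.\<close>

lemma std_normal_density_mult_exp:
  "std_normal_density x * exp (z * x) = exp (z\<^sup>2 / 2) * normal_density z 1 x"
  by (simp add: std_normal_density_def normal_density_def power2_eq_square field_simps flip: exp_add)

lemma integrable_std_normal_exp: "integrable std_normal_distribution (\<lambda>x. exp (z * x))"
  by (simp add: integrable_density std_normal_density_mult_exp)

lemma integrable_std_normal_exp_abs: "integrable std_normal_distribution (\<lambda>x. exp (a * \<bar>x\<bar>))"
proof (rule Bochner_Integration.integrable_bound)
  show "integrable std_normal_distribution (\<lambda>x. exp (a * x) + exp (- a * x))"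
    by (intro Bochner_Integration.integrable_add integrable_std_normal_exp)
  show "AE x in std_normal_distribution. norm (exp (a * \<bar>x\<bar>)) \<le> norm (exp (a * x) + exp (- a * x))"
  proof (intro AE_I2)
    fix x
    have "exp (a * \<bar>x\<bar>) \<le> exp (a * x) + exp (- a * x)"
      by (cases "x \<ge> 0") auto
    also have "\<dots> \<le> norm (exp (a * x) + exp (- a * x))"
      by (simp only: real_norm_def abs_ge_self)
    finally show "norm (exp (a * \<bar>x\<bar>)) \<le> norm (exp (a * x) + exp (- a * x))"
      by (simp only: real_norm_def abs_exp_cancel)
  qed
qed simp

text \<open>The shift moves from \<open>f\<close> to the Gaussian density. Afterwards
  \<open>z\<close> occurs only in smooth factors, so the integral can be differentiated in
  \<open>z\<close> even where \<open>f\<close> jumps.\<close>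

lemma integral_std_normal_shift:
  fixes f :: "real \<Rightarrow> real"
  assumes [measurable]: "f \<in> borel_measurable borel"
  shows "(\<integral>x. f (x + z) \<partial>std_normal_distribution) =
    exp (- z\<^sup>2 / 2) * (\<integral>x. f x * exp (z * x) \<partial>std_normal_distribution)"
proof -
  have "(\<integral>x. f (x + z) \<partial>std_normal_distribution) = (\<integral>x. std_normal_density x * f (x + z) \<partial>lborel)"
    by (subst integral_density) auto
  also have "\<dots> = (\<integral>x. std_normal_density (- z + x) * f (- z + x + z) \<partial>lborel)"
    by (subst lborel_integral_real_affine[of 1 _ "- z"]) auto
  also have "\<dots> = (\<integral>x. exp (- z\<^sup>2 / 2) * (std_normal_density x * (f x * exp (z * x))) \<partial>lborel)"
  proof (intro Bochner_Integration.integral_cong refl)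
    fix x
    have "std_normal_density (- z + x) = exp (- z\<^sup>2 / 2) * (std_normal_density x * exp (z * x))"
      by (simp add: std_normal_density_def power2_eq_square field_simps flip: exp_add)
    then show "std_normal_density (- z + x) * f (- z + x + z) =
        exp (- z\<^sup>2 / 2) * (std_normal_density x * (f x * exp (z * x)))" by simp
  qed
  also have "\<dots> = exp (- z\<^sup>2 / 2) * (\<integral>x. f x * exp (z * x) \<partial>std_normal_distribution)"
    by (subst integral_density) auto
  finally show ?thesis .
qed

lemma has_derivative_std_normal_mgf:
  fixes f :: "real \<Rightarrow> real"
  assumes [measurable]: "f \<in> borel_measurable borel" and bnd: "\<And>x. \<bar>f x\<bar> \<le> C"
  shows "((\<lambda>z. \<integral>x. f x * exp (z * x) \<partial>std_normal_distribution) has_real_derivative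
    (\<integral>x. f x * x \<partial>std_normal_distribution)) (at 0)"
  unfolding has_field_derivative_iff tendsto_at_iff_sequentially
proof (intro allI impI)
  have C: "C \<ge> 0" using bnd[of 0] by linarith
  fix X :: "nat \<Rightarrow> real" assume X0: "\<forall>i. X i \<in> UNIV - {0}" and X: "X \<longlonglongrightarrow> 0"
  obtain B where B: "\<And>i. \<bar>X i\<bar> \<le> B"
    using convergent_imp_Bseq[OF convergentI[OF X]] by (auto simp: Bseq_def)
  let ?H = "\<lambda>z. \<integral>x. f x * exp (z * x) \<partial>std_normal_distribution"
  have int: "integrable std_normal_distribution (\<lambda>x. f x * exp (z * x))" for z
    by (rule Bochner_Integration.integrable_bound[OF integrable_mult_right[OF integrable_std_normal_exp, of C z]])
       (use bnd C in \<open>auto simp: abs_mult intro!: mult_right_mono\<close>)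
  have eq: "(?H z - ?H 0) / (z - 0) = (\<integral>x. f x * ((exp (z * x) - 1) / z) \<partial>std_normal_distribution)" for z
  proof -
    have "?H z - ?H 0 = (\<integral>x. f x * exp (z * x) - f x * exp (0 * x) \<partial>std_normal_distribution)"
      using int by (intro Bochner_Integration.integral_diff[symmetric])
    then have "(?H z - ?H 0) / z =
        (\<integral>x. (f x * exp (z * x) - f x * exp (0 * x)) / z \<partial>std_normal_distribution)"
      by simp
    then show ?thesis by (simp add: algebra_simps diff_divide_distrib)
  qed
  have "(\<lambda>i. \<integral>x. f x * ((exp (X i * x) - 1) / X i) \<partial>std_normal_distribution) \<longlonglongrightarrow>
      (\<integral>x. f x * x \<partial>std_normal_distribution)"
  proof (rule integral_dominated_convergence)
    \<comment> \<open>In the exponent, \<open>B\<close> bounds the null sequence and the summand 1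
      absorbs the factor |x| \<le> exp |x| that appears in the difference quotient.\<close>
    show "integrable std_normal_distribution (\<lambda>x. C * exp ((1 + B) * \<bar>x\<bar>))"
      by (intro integrable_mult_right integrable_std_normal_exp_abs)
    show "AE x in std_normal_distribution. (\<lambda>i. f x * ((exp (X i * x) - 1) / X i)) \<longlonglongrightarrow> f x * x"
    proof (intro AE_I2 tendsto_mult_left)
      fix x
      have "((\<lambda>z. exp (z * x)) has_real_derivative x) (at 0)"
        by (auto intro!: derivative_eq_intros)
      then show "(\<lambda>i. (exp (X i * x) - 1) / X i) \<longlonglongrightarrow> x"
        using X X0 unfolding has_field_derivative_iff tendsto_at_iff_sequentially by (auto simp: o_def)
    qed
    show "AE x in std_normal_distribution.
        norm (f x * ((exp (X i * x) - 1) / X i)) \<le> C * exp ((1 + B) * \<bar>x\<bar>)" for i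
    proof (intro AE_I2)
      fix x
      have "\<bar>(exp (X i * x) - 1) / X i\<bar> \<le> \<bar>x\<bar> * exp \<bar>X i * x\<bar>"
        using abs_exp_diff_one_le[of "X i * x"] X0 by (simp add: abs_mult field_simps)
      also have "\<dots> \<le> exp \<bar>x\<bar> * exp (B * \<bar>x\<bar>)"
        using exp_ge_add_one_self[of "\<bar>x\<bar>"] B[of i]
        by (intro mult_mono) (auto simp: abs_mult intro!: mult_right_mono simp del: exp_ge_add_one_self)
      finally have "\<bar>(exp (X i * x) - 1) / X i\<bar> \<le> exp ((1 + B) * \<bar>x\<bar>)"
        by (simp add: algebra_simps exp_add)
      then have "\<bar>f x\<bar> * \<bar>(exp (X i * x) - 1) / X i\<bar> \<le> C * exp ((1 + B) * \<bar>x\<bar>)"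
        using bnd C by (intro mult_mono) auto
      then show "norm (f x * ((exp (X i * x) - 1) / X i)) \<le> C * exp ((1 + B) * \<bar>x\<bar>)"
        by (simp only: real_norm_def abs_mult)
    qed
  qed auto
  then show "((\<lambda>y. (?H y - ?H 0) / (y - 0)) \<circ> X) \<longlonglongrightarrow> (\<integral>x. f x * x \<partial>std_normal_distribution)"
    unfolding o_def eq .
qed

text \<open>The prefactor exp (- z^2 / 2) has value 1 and derivative 0 at 0, so only the tilt
  contributes. The result is the Gaussian integration by parts formula, without a derivative of
  \<open>f\<close>.\<close>

lemma has_derivative_std_normal_shift:
  fixes f :: "real \<Rightarrow> real"
  assumes [measurable]: "f \<in> borel_measurable borel" and bnd: "\<And>x. \<bar>f x\<bar> \<le> C"
  shows "((\<lambda>z. \<integral>x. f (x + z) \<partial>std_normal_distribution) has_real_derivative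
    (\<integral>x. f x * x \<partial>std_normal_distribution)) (at 0)"
  unfolding integral_std_normal_shift[OF assms(1)]
  by (rule derivative_eq_intros has_derivative_std_normal_mgf[OF assms] refl | simp)+

lemma integral_std_normal_odd:
  fixes f :: "real \<Rightarrow> real"
  assumes "\<And>x. f (- x) = - f x"
  shows "(\<integral>x. f x \<partial>std_normal_distribution) = 0"
proof (cases "f \<in> borel_measurable borel")
  case True
  then have "(\<integral>x. f x \<partial>std_normal_distribution) = (\<integral>x. std_normal_density x * f x \<partial>lborel)"
    by (subst integral_density) auto
  also have "\<dots> = (\<integral>x. std_normal_density (0 + (- 1) * x) * f (0 + (- 1) * x) \<partial>lborel)"
    by (subst lborel_integral_real_affine[of "- 1" _ 0]) auto
  also have "\<dots> = - (\<integral>x. std_normal_density x * f x \<partial>lborel)"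
    by (simp add: assms std_normal_density_def)
  also have "(\<integral>x. std_normal_density x * f x \<partial>lborel) = (\<integral>x. f x \<partial>std_normal_distribution)"
    using True by (subst integral_density) auto
  finally show ?thesis by simp
\<comment> \<open>A non-measurable function is not integrable, and its integral is 0 by
  convention.\<close>
qed (auto intro!: not_integrable_integral_eq dest: borel_measurable_integrable)

text \<open>A zero integral would make \<open>f\<close> vanish almost everywhere, also for Lebesgue
  measure since the Gaussian density is positive, but \<open>f\<close> is positive on
  [a, a + 1].\<close>

lemma integral_std_normal_pos:
  fixes f :: "real \<Rightarrow> real"
  assumes int: "integrable std_normal_distribution f" and "\<And>x. f x \<ge> 0" and pos: "\<And>x. x \<ge> a \<Longrightarrow> f x > 0"
  shows "(\<integral>x. f x \<partial>std_normal_distribution) > 0"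
proof (rule ccontr)
  assume "\<not> ?thesis"
  moreover have "(\<integral>x. f x \<partial>std_normal_distribution) \<ge> 0"
    using assms by (intro integral_nonneg_AE) auto
  ultimately have "AE x in std_normal_distribution. f x = 0"
    using integral_nonneg_eq_0_iff_AE[OF int AE_I2[OF assms(2)]] by linarith
  then have "AE x in lborel. std_normal_density x > 0 \<longrightarrow> f x = 0"
    by (subst (asm) AE_density) simp_all
  then have "AE x in lborel. x \<notin> {a..a+1}"
  proof eventually_elim
    case (elim x)
    then show ?case using pos[of x] normal_density_pos[of 1 0 x] by auto
  qed
  then have "{a..a+1} \<in> null_sets lborel"
    by (simp add: AE_iff_null_sets)
  then show False by auto
qed

section \<open>Estimators on a random partition\<close>

definition estimator_law ::
    "'x measure \<Rightarrow> (nat \<Rightarrow> (nat \<Rightarrow> 'x) \<Rightarrow> real) \<Rightarrow> nat \<Rightarrow> real measure" where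
  "estimator_law P est n = distr (PiM {..<n} (\<lambda>_. P)) borel (est n)"

context prob_space
begin

lemma distr_restrict_eq_PiM:
  assumes ind: "indep_vars (\<lambda>_. P) X A"
    and law: "\<And>i. i \<in> A \<Longrightarrow> distr M P (X i) = P"
  shows "distr M (PiM A (\<lambda>_. P)) (\<lambda>\<omega>. \<lambda>i\<in>A. X i \<omega>) = PiM A (\<lambda>_. P)"
proof (cases "A = {}")
  \<comment> \<open>This case covers groups of size 0, which occur when there are more groups than
    observations. The product space is then a single point and carries only one probability
    measure.\<close>
  case True
  interpret E: prob_space "PiM {} (\<lambda>_. P)" by (rule prob_space_PiM) auto
  interpret D: prob_space "distr M (PiM {} (\<lambda>_. P)) (\<lambda>\<omega>. \<lambda>i\<in>{}. X i \<omega>)"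
    by (rule prob_space_distr) (auto intro!: measurable_restrict)
  show ?thesis unfolding True
  proof (rule measure_eqI)
    fix B assume "B \<in> sets (distr M (PiM {} (\<lambda>_. P)) (\<lambda>\<omega>. \<lambda>i\<in>{}. X i \<omega>))"
    then have "B = {} \<or> B = space (PiM {} (\<lambda>_. P))"
      by (auto simp: PiM_empty space_PiM)
    then show "emeasure (distr M (PiM {} (\<lambda>_. P)) (\<lambda>\<omega>. \<lambda>i\<in>{}. X i \<omega>)) B = emeasure (PiM {} (\<lambda>_. P)) B"
      using D.emeasure_space_1 E.emeasure_space_1 by auto
  qed simp
next
  case False
  have "distr M (PiM A (\<lambda>_. P)) (\<lambda>\<omega>. \<lambda>i\<in>A. X i \<omega>) = PiM A (\<lambda>i. distr M P (X i))"
    using indep_vars_iff_distr_eq_PiM'[OF False, where M'="\<lambda>_. P" and X=X] ind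
    by (auto simp: indep_vars_def)
  also have "\<dots> = PiM A (\<lambda>_. P)"
    by (rule PiM_cong) (auto simp: law)
  finally show ?thesis .
qed

text \<open>The groups are deterministic here; a random partition is reduced to this case by
  conditioning on its value.\<close>

lemma group_estimate_fixed:
  fixes est :: "nat \<Rightarrow> (nat \<Rightarrow> 'x) \<Rightarrow> real"
  assumes P: "prob_space P"
    and ind: "indep_vars (\<lambda>_. P) X I" and law: "\<And>i. i \<in> I \<Longrightarrow> distr M P (X i) = P"
    and A: "\<And>j. j \<in> J \<Longrightarrow> A j \<subseteq> I" "\<And>j. j \<in> J \<Longrightarrow> card (A j) = n" "finite I"
    and disj: "disjoint_family_on A J"
    and est: "est n \<in> borel_measurable (PiM {..<n} (\<lambda>_. P))"
  shows "indep_vars (\<lambda>_. borel) (\<lambda>j. group_estimate est X (A j)) J"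
    and "\<And>j. j \<in> J \<Longrightarrow> distr M borel (group_estimate est X (A j)) = estimator_law P est n"
proof -
  define f where "f j = (!) (sorted_list_of_set (A j))" for j
  \<comment> \<open>\<open>r j\<close> relabels a family indexed by \<open>A j\<close> as a sample
    indexed by \<open>{..<n}\<close>, in increasing order. As the relabelling is bijective, it maps
    product measure to product measure, and the dependence on \<open>A j\<close> disappears from the
    law.\<close>
  define r where "r j x = (\<lambda>i\<in>{..<n}. x (f j i))" for j and x :: "nat \<Rightarrow> 'x"
  have bij: "bij_betw (f j) {..<n} (A j)" if "j \<in> J" for j
    unfolding f_def
    using that A finite_subset[OF A(1)[OF that] A(3)]
    by (intro bij_betw_nth) (auto simp: lessThan_def)
  have r: "r j \<in> PiM (A j) (\<lambda>_. P) \<rightarrow>\<^sub>M PiM {..<n} (\<lambda>_. P)" if "j \<in> J" for j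
    unfolding r_def using bij_betw_apply[OF bij[OF that]]
    by (intro measurable_restrict measurable_component_singleton) auto
  have h: "est n \<circ> r j \<in> borel_measurable (PiM (A j) (\<lambda>_. P))" if "j \<in> J" for j
    using r[OF that] est by (rule measurable_comp)
  have ge: "group_estimate est X (A j) \<omega> = (est n \<circ> r j) (\<lambda>i\<in>A j. X i \<omega>)" if "j \<in> J" for j \<omega>
    unfolding group_estimate_def A(2)[OF that] o_def r_def f_def[symmetric]
    using bij_betw_apply[OF bij[OF that]] by (intro arg_cong[where f="est n"]) (auto simp: fun_eq_iff)
  have "indep_vars (\<lambda>j. PiM (A j) (\<lambda>_. P)) (\<lambda>j \<omega>. \<lambda>i\<in>A j. X i \<omega>) J"
    using ind A(1) disj by (rule indep_vars_restrict)
  then have "indep_vars (\<lambda>_. borel) (\<lambda>j \<omega>. (est n \<circ> r j) (\<lambda>i\<in>A j. X i \<omega>)) J"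
    using h by (rule indep_vars_compose2)
  then show "indep_vars (\<lambda>_. borel) (\<lambda>j. group_estimate est X (A j)) J"
    by (rule indep_vars_cong[THEN iffD1, rotated -1]) (auto simp: ge fun_eq_iff)
  fix j assume j: "j \<in> J"
  have X: "indep_vars (\<lambda>_. P) X (A j)"
    using ind A(1)[OF j] by (rule indep_vars_subset)
  then have Xm: "(\<lambda>\<omega>. \<lambda>i\<in>A j. X i \<omega>) \<in> M \<rightarrow>\<^sub>M PiM (A j) (\<lambda>_. P)"
    by (intro measurable_restrict) (auto simp: indep_vars_def)
  have "distr M borel (group_estimate est X (A j)) =
      distr M borel ((est n \<circ> r j) \<circ> (\<lambda>\<omega>. \<lambda>i\<in>A j. X i \<omega>))"
    using ge[OF j] by (intro arg_cong[where f="distr M borel"]) (auto simp: fun_eq_iff)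
  also have "\<dots> = distr (distr M (PiM (A j) (\<lambda>_. P)) (\<lambda>\<omega>. \<lambda>i\<in>A j. X i \<omega>)) borel (est n \<circ> r j)"
    using h[OF j] Xm by (rule distr_distr[symmetric])
  also have "\<dots> = distr (PiM (A j) (\<lambda>_. P)) borel (est n \<circ> r j)"
    using X law A(1)[OF j] by (subst distr_restrict_eq_PiM) auto
  also have "\<dots> = distr (distr (PiM (A j) (\<lambda>_. P)) (PiM {..<n} (\<lambda>_. P)) (r j)) borel (est n)"
    using est r[OF j] by (rule distr_distr[symmetric])
  also have "distr (PiM (A j) (\<lambda>_. P)) (PiM {..<n} (\<lambda>_. P)) (r j) = PiM {..<n} (\<lambda>_. P)"
    unfolding r_def using bij[OF j] P
    by (intro distr_PiM_reindex) (auto simp: bij_betw_def)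
  finally show "distr M borel (group_estimate est X (A j)) = estimator_law P est n"
    by (simp add: estimator_law_def)
qed

text \<open>On the event that the partition equals \<open>A\<close>, the estimators are those of the
  fixed groups \<open>A\<close>, which are functions of the data alone. Independence of data and
  partition splits off the probability of this event, and the remaining factor is the same product
  for every \<open>A\<close>. Summing over the finitely many values gives the product law.\<close>

lemma random_group_estimate:
  fixes est :: "nat \<Rightarrow> (nat \<Rightarrow> 'x) \<Rightarrow> real"
  assumes P: "prob_space P"
    and ind: "indep_vars (\<lambda>_. P) X I" and law: "\<And>i. i \<in> I \<Longrightarrow> distr M P (X i) = P"
    and fin: "finite I" "finite J" "J \<noteq> {}"
    and G: "\<And>j \<omega>. \<omega> \<in> space M \<Longrightarrow> j \<in> J \<Longrightarrow> G j \<omega> \<subseteq> I \<and> card (G j \<omega>) = n"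
    and disj: "\<And>\<omega>. \<omega> \<in> space M \<Longrightarrow> disjoint_family_on (\<lambda>j. G j \<omega>) J"
    and XG: "indep_rv M (PiM I (\<lambda>_. P)) (\<lambda>\<omega>. \<lambda>i\<in>I. X i \<omega>)
      (PiM J (\<lambda>_. count_space (Pow I))) (\<lambda>\<omega>. \<lambda>j\<in>J. G j \<omega>)"
    and est: "est n \<in> borel_measurable (PiM {..<n} (\<lambda>_. P))"
  defines "E \<equiv> \<lambda>j \<omega>. group_estimate est X (G j \<omega>) \<omega>"
  shows "indep_vars (\<lambda>_. borel) E J"
    and "\<And>j. j \<in> J \<Longrightarrow> distr M borel (E j) = estimator_law P est n"
proof -
  define \<mu> where "\<mu> = estimator_law P est n"
  have \<mu>: "prob_space \<mu>"
    unfolding \<mu>_def estimator_law_def using P est by (intro prob_space.prob_space_distr prob_space_PiM)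
  let ?X = "\<lambda>\<omega>. \<lambda>i\<in>I. X i \<omega>" and ?G = "\<lambda>\<omega>. \<lambda>j\<in>J. G j \<omega>"
  let ?SX = "sets (vimage_algebra (space M) ?X (PiM I (\<lambda>_. P)))"
  let ?SG = "sets (vimage_algebra (space M) ?G (PiM J (\<lambda>_. count_space (Pow I))))"
  define \<Gamma> where "\<Gamma> = PiE J (\<lambda>_. Pow I)"
  have \<Gamma>: "finite \<Gamma>" "\<And>\<omega>. \<omega> \<in> space M \<Longrightarrow> ?G \<omega> \<in> \<Gamma>"
    using fin G by (auto simp: \<Gamma>_def intro!: finite_PiE)
  have SX: "?SX \<subseteq> events" and SG: "?SG \<subseteq> events"
    and prod: "\<And>a b. a \<in> ?SX \<Longrightarrow> b \<in> ?SG \<Longrightarrow> prob (a \<inter> b) = prob a * prob b"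
    using XG unfolding indep_rv_def indep_sets2_eq by blast+
  have evG: "{\<omega> \<in> space M. ?G \<omega> = A} \<in> ?SG" if "A \<in> \<Gamma>" for A
  proof -
    have "PiE J (\<lambda>j. {A j}) \<in> sets (PiM J (\<lambda>_. count_space (Pow I)))"
      using that fin by (intro sets_PiM_I_finite) (auto simp: \<Gamma>_def PiE_iff)
    also have "PiE J (\<lambda>j. {A j}) = {A}"
      using that by (intro PiE_singleton) (auto simp: \<Gamma>_def PiE_def)
    finally have "{A} \<in> sets (PiM J (\<lambda>_. count_space (Pow I)))" .
    from in_vimage_algebra[OF this, of ?G "space M"] show ?thesis
      by (simp add: vimage_def Int_def conj_commute)
  qed
  have box: "{\<omega> \<in> space M. \<forall>j\<in>J. E j \<omega> \<in> B j} \<in> events \<and>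
      prob {\<omega> \<in> space M. \<forall>j\<in>J. E j \<omega> \<in> B j} = (\<Prod>j\<in>J. measure \<mu> (B j))"
    if B: "\<And>j. j \<in> J \<Longrightarrow> B j \<in> sets borel" for B
  proof -
    let ?D = "\<lambda>A. {\<omega> \<in> space M. \<forall>j\<in>J. group_estimate est X (A j) \<omega> \<in> B j}"
    let ?Q = "\<lambda>A. {\<omega> \<in> space M. ?G \<omega> = A \<and> (\<forall>j\<in>J. E j \<omega> \<in> B j)}"
    have piece: "?Q A \<in> events \<and> prob (?Q A) = (\<Prod>j\<in>J. measure \<mu> (B j)) * prob {\<omega> \<in> space M. ?G \<omega> = A}"
      if A: "A \<in> \<Gamma>" for A
    \<comment> \<open>A value that is never attained need not consist of disjoint groups of size
      \<open>n\<close>, so the lemma on fixed groups does not apply to it; both sides are then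
      0.\<close>
    proof (cases "\<exists>\<omega>\<in>space M. ?G \<omega> = A")
      case False
      then have "?Q A = {}" "{\<omega> \<in> space M. ?G \<omega> = A} = {}" by auto
      then show ?thesis by (simp only:) simp
    next
      case True
      then obtain \<omega>0 where \<omega>0: "\<omega>0 \<in> space M" "?G \<omega>0 = A" by blast
      then have AG: "A j = G j \<omega>0" if "j \<in> J" for j using that by auto
      have Asub: "A j \<subseteq> I" "card (A j) = n" if "j \<in> J" for j
        using G[OF \<omega>0(1) that] AG[OF that] by auto
      have Adisj: "disjoint_family_on A J"
        using disj[OF \<omega>0(1)] by (auto simp: disjoint_family_on_def AG)
      note fixed = group_estimate_fixed[where est=est and A=A and J=J, OF P ind law Asub fin(1) Adisj est]
      \<comment> \<open>Independence from the partition concerns the sigma-algebra generated by the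
        data, so it is not enough that \<open>?D A\<close> is an event. The functions
        \<open>h j\<close> exhibit the estimators as measurable functions of the sample.\<close>
      have "?D A \<in> ?SX"
      proof -
        define h where "h j x = group_estimate est (\<lambda>i x. x i) (A j) x" for j and x :: "nat \<Rightarrow> 'x"
        have h: "h j \<in> borel_measurable (PiM I (\<lambda>_. P))" if "j \<in> J" for j
        proof -
          have "sorted_list_of_set (A j) ! i \<in> I" if "i < n" for i
            using Asub[OF \<open>j \<in> J\<close>] fin that finite_subset[OF Asub(1)[OF \<open>j \<in> J\<close>] fin(1)]
              nth_mem[of i "sorted_list_of_set (A j)"] by auto
          then show ?thesis
            unfolding h_def group_estimate_def Asub(2)[OF that]
            by (intro measurable_compose[OF _ est] measurable_restrict measurable_component_singleton) auto
        qed
        have hX: "h j (?X \<omega>) = group_estimate est X (A j) \<omega>" if "j \<in> J" for j \<omega>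
        proof -
          have "sorted_list_of_set (A j) ! i \<in> I" if "i < n" for i
            using Asub[OF \<open>j \<in> J\<close>] fin that finite_subset[OF Asub(1)[OF \<open>j \<in> J\<close>] fin(1)]
              nth_mem[of i "sorted_list_of_set (A j)"] by auto
          then show ?thesis
            unfolding h_def group_estimate_def Asub(2)[OF that]
            by (intro arg_cong[where f="est n"]) (auto simp: fun_eq_iff)
        qed
        have "{x \<in> space (PiM I (\<lambda>_. P)). \<forall>j\<in>J. h j x \<in> B j} \<in> sets (PiM I (\<lambda>_. P))"
        proof (rule sets.sets_Collect_finite_All)
          show "{x \<in> space (PiM I (\<lambda>_. P)). h j x \<in> B j} \<in> sets (PiM I (\<lambda>_. P))" if "j \<in> J" for j
            using measurable_sets[OF h[OF that] B[OF that]] by (simp add: vimage_def Int_def conj_commute)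
        qed (fact fin)
        from in_vimage_algebra[OF this, of ?X "space M"]
        have "?X -` {x \<in> space (PiM I (\<lambda>_. P)). \<forall>j\<in>J. h j x \<in> B j} \<inter> space M \<in> ?SX" .
        also have "?X -` {x \<in> space (PiM I (\<lambda>_. P)). \<forall>j\<in>J. h j x \<in> B j} \<inter> space M = ?D A"
          using ind by (auto simp: hX space_PiM indep_vars_def measurable_space)
        finally show ?thesis .
      qed
      moreover have "?Q A = ?D A \<inter> {\<omega> \<in> space M. ?G \<omega> = A}"
        by (auto simp: E_def)
      moreover have "prob (?D A) = (\<Prod>j\<in>J. measure \<mu> (B j))"
      proof -
        have m: "random_variable borel (group_estimate est X (A j))" if "j \<in> J" for j
          using fixed(1) that by (auto simp: indep_vars_def)
        have "?D A = (\<Inter>j\<in>J. group_estimate est X (A j) -` B j \<inter> space M)"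
          using fin by auto
        also have "prob \<dots> = (\<Prod>j\<in>J. prob (group_estimate est X (A j) -` B j \<inter> space M))"
          using fin B fixed(1) by (intro indep_varsD) auto
        also have "\<dots> = (\<Prod>j\<in>J. measure \<mu> (B j))"
          using fixed(2) m B by (intro prod.cong refl) (simp add: \<mu>_def measure_distr flip: fixed(2))
        finally show ?thesis .
      qed
      ultimately show ?thesis
        using prod evG[OF A] SX SG by auto
    qed
    have eq: "{\<omega> \<in> space M. \<forall>j\<in>J. E j \<omega> \<in> B j} = (\<Union>A\<in>\<Gamma>. ?Q A)"
      using \<Gamma>(2) by blast
    have "prob (\<Union>A\<in>\<Gamma>. ?Q A) = (\<Sum>A\<in>\<Gamma>. prob (?Q A))"
      using piece \<Gamma>(1) by (intro finite_measure_finite_Union) (auto simp: disjoint_family_on_def)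
    also have "\<dots> = (\<Prod>j\<in>J. measure \<mu> (B j)) * (\<Sum>A\<in>\<Gamma>. prob {\<omega> \<in> space M. ?G \<omega> = A})"
      using piece by (simp add: sum_distrib_left)
    also have "(\<Sum>A\<in>\<Gamma>. prob {\<omega> \<in> space M. ?G \<omega> = A}) = prob (\<Union>A\<in>\<Gamma>. {\<omega> \<in> space M. ?G \<omega> = A})"
      using evG SG \<Gamma>(1) by (intro finite_measure_finite_Union[symmetric]) (auto simp: disjoint_family_on_def)
    also have "(\<Union>A\<in>\<Gamma>. {\<omega> \<in> space M. ?G \<omega> = A}) = space M"
      using \<Gamma>(2) by blast
    finally have "prob (\<Union>A\<in>\<Gamma>. ?Q A) = (\<Prod>j\<in>J. measure \<mu> (B j))"
      by (simp only: prob_space mult_1_right)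
    moreover have "(\<Union>A\<in>\<Gamma>. ?Q A) \<in> events"
      using piece \<Gamma>(1) by (intro sets.finite_UN) blast+
    ultimately show ?thesis unfolding eq by blast
  qed
  have single: "E j -` S \<inter> space M \<in> events" "prob (E j -` S \<inter> space M) = measure \<mu> S"
    if j: "j \<in> J" and S: "S \<in> sets borel" for j S
  proof -
    let ?B = "\<lambda>i. if i = j then S else UNIV"
    have *: "{\<omega> \<in> space M. \<forall>i\<in>J. E i \<omega> \<in> ?B i} = E j -` S \<inter> space M"
      using j by auto
    have "measure \<mu> UNIV = 1"
      using prob_space.prob_space[OF \<mu>] by (simp add: \<mu>_def estimator_law_def)
    then have "(\<Prod>i\<in>J. measure \<mu> (?B i)) = (\<Prod>i\<in>J. if i = j then measure \<mu> S else 1)"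
      by (intro prod.cong) auto
    then have "(\<Prod>i\<in>J. measure \<mu> (?B i)) = measure \<mu> S"
      using j fin by simp
    with box[of ?B] S show "E j -` S \<inter> space M \<in> events" "prob (E j -` S \<inter> space M) = measure \<mu> S"
      unfolding * by auto
  qed
  have rv: "random_variable borel (E j)" if "j \<in> J" for j
    using single(1)[OF that] by (intro measurableI) auto
  show "indep_vars (\<lambda>_. borel) E J"
  proof (subst indep_vars_finite[where E="\<lambda>_. sets borel"])
    show "\<forall>A\<in>J \<rightarrow> sets borel. prob (\<Inter>j\<in>J. E j -` A j \<inter> space M) = (\<Prod>j\<in>J. prob (E j -` A j \<inter> space M))"
    proof
      fix A assume A: "A \<in> J \<rightarrow> sets (borel :: real measure)"
      have "(\<Inter>j\<in>J. E j -` A j \<inter> space M) = {\<omega> \<in> space M. \<forall>j\<in>J. E j \<omega> \<in> A j}"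
        using fin by auto
      then show "prob (\<Inter>j\<in>J. E j -` A j \<inter> space M) = (\<Prod>j\<in>J. prob (E j -` A j \<inter> space M))"
        using box[of A] A single(2) by (auto simp: Pi_iff intro!: prod.cong)
    qed
  qed (use fin rv sets.sigma_sets_eq[of borel] in \<open>auto simp: Int_stable_def\<close>)
  show "distr M borel (E j) = estimator_law P est n" if j: "j \<in> J" for j
  proof (rule measure_eqI)
    interpret \<mu>: prob_space \<mu> by fact
    fix S assume "S \<in> sets (distr M borel (E j))"
    then show "emeasure (distr M borel (E j)) S = emeasure (estimator_law P est n) S"
      using single(2)[OF j, of S] rv[OF j]
      by (simp add: emeasure_distr emeasure_eq_measure \<mu>.emeasure_eq_measure flip: \<mu>_def)
  qed (simp add: estimator_law_def)
qed

end

section \<open>The limit law\<close>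

lemma filterlim_inverse_sqrt_at_0:
  fixes k :: "nat \<Rightarrow> nat"
  assumes "filterlim k at_top sequentially"
  shows "filterlim (\<lambda>N. 1 / sqrt (real (k N))) (at 0) sequentially"
proof (rule filterlim_atI)
  have "filterlim (\<lambda>N. sqrt (real (k N))) at_top sequentially"
    by (intro filterlim_compose[OF sqrt_at_top] filterlim_compose[OF filterlim_real_sequentially] assms)
  then show "(\<lambda>N. 1 / sqrt (real (k N))) \<longlonglongrightarrow> 0"
    by (intro tendsto_divide_0[OF tendsto_const] filterlim_at_top_imp_at_infinity)
  show "\<forall>\<^sub>F N in sequentially. 1 / sqrt (real (k N)) \<noteq> 0"
    using eventually_compose_filterlim[OF eventually_gt_at_top assms, of 0] by eventually_elim simp
qed

section \<open>Central limit theorem for the score sums\<close>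

lemma char_distr_affine_sum:
  fixes X :: "'i \<Rightarrow> 'w \<Rightarrow> real"
  assumes "prob_space M" and ind: "prob_space.indep_vars M (\<lambda>_. borel) X J"
    and law: "\<And>j. j \<in> J \<Longrightarrow> distr M borel (X j) = \<mu>"
  shows "char (distr M borel (\<lambda>\<omega>. ((\<Sum>j\<in>J. X j \<omega>) / r + d) / v)) s =
    iexp (s * d / v) * char \<mu> (s / v / r) ^ card J"
proof -
  interpret prob_space M by fact
  have [measurable]: "random_variable borel (X j)" if "j \<in> J" for j
    using ind that by (simp add: indep_vars_def)
  have "char (distr M borel (\<lambda>\<omega>. ((\<Sum>j\<in>J. X j \<omega>) / r + d) / v)) s =
      (CLINT \<omega>|M. iexp (s * (((\<Sum>j\<in>J. X j \<omega>) / r + d) / v)))"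
    by (simp add: char_def integral_distr)
  also have "\<dots> = (CLINT \<omega>|M. iexp (s * d / v) * iexp (s / v / r * (\<Sum>j\<in>J. X j \<omega>)))"
  proof (intro Bochner_Integration.integral_cong refl)
    fix \<omega>
    have "s * (((\<Sum>j\<in>J. X j \<omega>) / r + d) / v) = s * d / v + s / v / r * (\<Sum>j\<in>J. X j \<omega>)"
      by (simp add: add_divide_distrib distrib_left)
    then show "iexp (s * (((\<Sum>j\<in>J. X j \<omega>) / r + d) / v)) =
        iexp (s * d / v) * iexp (s / v / r * (\<Sum>j\<in>J. X j \<omega>))"
      by (simp only: of_real_add distrib_left exp_add)
  qed
  also have "\<dots> = iexp (s * d / v) * char (distr M borel (\<lambda>\<omega>. \<Sum>j\<in>J. X j \<omega>)) (s / v / r)"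
    by (simp add: char_def integral_distr)
  also have "char (distr M borel (\<lambda>\<omega>. \<Sum>j\<in>J. X j \<omega>)) (s / v / r) = (\<Prod>j\<in>J. char (distr M borel (X j)) (s / v / r))"
    using ind by (rule char_distr_sum)
  also have "\<dots> = char \<mu> (s / v / r) ^ card J"
    by (simp add: law)
  finally show ?thesis .
qed

text \<open>Orders of growth for x summands at frequency b / sqrt x: linear terms grow like sqrt x,
  quadratic ones are constant, cubic ones vanish.\<close>

lemma mult_sqrt_powers:
  assumes "x > 0"
  shows "x * \<bar>b / sqrt x\<bar> = \<bar>b\<bar> * sqrt x" "x * \<bar>b / sqrt x\<bar> ^ 3 = \<bar>b\<bar> ^ 3 * (1 / sqrt x)"
    "x * (b / sqrt x)\<^sup>2 = b\<^sup>2" "x * (b / sqrt x) = b * sqrt x"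
proof -
  define r where "r = sqrt x"
  have r: "r > 0" "x = r * r" "sqrt x = r" using assms by (simp_all add: r_def)
  show "x * \<bar>b / sqrt x\<bar> = \<bar>b\<bar> * sqrt x" "x * \<bar>b / sqrt x\<bar> ^ 3 = \<bar>b\<bar> ^ 3 * (1 / sqrt x)"
    "x * (b / sqrt x)\<^sup>2 = b\<^sup>2" "x * (b / sqrt x) = b * sqrt x"
    unfolding r(3) using r(1) by (simp_all add: r(2) field_simps eval_nat_numeral)
qed

text \<open>Here \<open>f\<close> abstracts the averaged derivative of the loss. By Gaussian
  integration by parts, \<open>c\<close> is the derivative at 0 of its smoothed version, that is,
  L'(0).\<close>

context
  fixes f :: "real \<Rightarrow> real" and C t c V :: real
  assumes f: "mono f" and bnd: "\<And>x. \<bar>f x\<bar> \<le> C" and odd: "\<And>x. f (- x) = - f x"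
  defines "c \<equiv> \<integral>x. f x * x \<partial>std_normal_distribution"
    and "V \<equiv> \<integral>x. (f x)\<^sup>2 \<partial>std_normal_distribution"
begin

lemma measurable_score [measurable]: "f \<in> borel_measurable borel"
  using f by (rule borel_measurable_mono)

text \<open>The mean of \<open>f\<close> vanishes at shift 0 by oddness, so the first sequence is a
  difference quotient in r = 1 / sqrt k of the smoothed function at shift - t r. For the second
  moment continuity in the shift suffices; it follows from differentiability applied to the square
  of \<open>f\<close>.\<close>

lemma score_shift_moments:
  fixes k :: "nat \<Rightarrow> nat"
  assumes k: "filterlim k at_top sequentially"
  shows "(\<lambda>N. sqrt (k N) * (\<integral>x. f (x - t / sqrt (k N)) \<partial>std_normal_distribution)) \<longlonglongrightarrow> - (t * c)"
    and "(\<lambda>N. \<integral>x. (f (x - t / sqrt (k N)))\<^sup>2 \<partial>std_normal_distribution) \<longlonglongrightarrow> V"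
proof -
  note r = filterlim_inverse_sqrt_at_0[OF k]
  let ?h = "\<lambda>z. \<integral>x. f (x + z) \<partial>std_normal_distribution"
  have "(?h has_real_derivative c) (at (- t * 0))"
    using has_derivative_std_normal_shift[OF measurable_score bnd] by (simp add: c_def)
  then have "((\<lambda>r. ?h (- t * r)) has_real_derivative c * (- t)) (at 0)"
    by (rule DERIV_chain2) (auto intro!: derivative_eq_intros)
  then have "((\<lambda>r. (?h (- t * r) - ?h (- t * 0)) / (r - 0)) \<longlongrightarrow> c * (- t)) (at 0)"
    by (simp only: has_field_derivative_iff)
  moreover have "?h (- t * 0) = 0"
    using integral_std_normal_odd[of f] odd by simp
  ultimately have "((\<lambda>r. ?h (- t * r) / r) \<longlongrightarrow> - (t * c)) (at 0)"
    by (simp add: mult.commute)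
  from filterlim_compose[OF this r]
  show "(\<lambda>N. sqrt (k N) * (\<integral>x. f (x - t / sqrt (k N)) \<partial>std_normal_distribution)) \<longlonglongrightarrow> - (t * c)"
    by (simp add: mult.commute)
  let ?h2 = "\<lambda>z. \<integral>x. (f (x + z))\<^sup>2 \<partial>std_normal_distribution"
  have "\<bar>(f x)\<^sup>2\<bar> \<le> C\<^sup>2" for x
    using power_mono[OF bnd abs_ge_zero, of x 2] by simp
  from has_derivative_std_normal_shift[OF borel_measurable_power[OF measurable_score] this]
  have "isCont ?h2 0"
    by (rule DERIV_isCont)
  moreover have "(\<lambda>N. - t * (1 / sqrt (k N))) \<longlonglongrightarrow> - t * 0"
    using r by (intro tendsto_mult_left) (simp add: filterlim_at)
  ultimately have "(\<lambda>N. ?h2 (- t * (1 / sqrt (k N)))) \<longlonglongrightarrow> ?h2 0"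
    by (intro isCont_tendsto_compose[of 0 ?h2]) simp_all
  then show "(\<lambda>N. \<integral>x. (f (x - t / sqrt (k N)))\<^sup>2 \<partial>std_normal_distribution) \<longlonglongrightarrow> V"
    by (simp add: V_def)
qed

text \<open>The characteristic function of the score under the law of one estimator is first replaced,
  at the cost of \<open>O(g / sqrt k)\<close>, by the one under the normal law.\<close>

lemma score_char_limit:
  fixes k :: "nat \<Rightarrow> nat" and \<mu> :: "nat \<Rightarrow> real measure"
  assumes k: "filterlim k at_top sequentially"
    and \<mu>: "\<And>N. real_distribution (\<mu> N)"
    and g: "\<And>N u. \<bar>cdf (\<mu> N) u - cdf std_normal_distribution u\<bar> \<le> g N"
    and g_lim: "(\<lambda>N. sqrt (k N) * g N) \<longlonglongrightarrow> 0"
  shows "(\<lambda>N. k N * (char (distr (\<mu> N) borel (\<lambda>y. f (y - t / sqrt (k N)))) (b / sqrt (k N)) - 1))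
    \<longlonglongrightarrow> - (\<i> * b * t * c) - b\<^sup>2 * V / 2"
proof -
  interpret Z: real_distribution std_normal_distribution by (rule real_dist_normal_dist)
  define fN where "fN N x = f (x - t / sqrt (k N))" for N x
  define m1 where "m1 N = (\<integral>x. fN N x \<partial>std_normal_distribution)" for N
  define m2 where "m2 N = (\<integral>x. (fN N x)\<^sup>2 \<partial>std_normal_distribution)" for N
  define ch where "ch N = char (distr (\<mu> N) borel (fN N)) (b / sqrt (k N))" for N
  define T where "T N = \<i> * b * (sqrt (k N) * m1 N) - b\<^sup>2 * m2 N / 2" for N
  have pos: "\<forall>\<^sub>F N in sequentially. k N > 0"
    using eventually_compose_filterlim[OF eventually_gt_at_top k] .
  have [measurable]: "fN N \<in> borel_measurable borel" for N
    unfolding fN_def by measurable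
  have fN: "mono (fN N)" "\<bar>fN N x\<bar> \<le> C" for N x
    using f bnd by (auto simp: fN_def mono_def)
  \<comment> \<open>The first error term comes from replacing the law by the normal one, the second
    from the third order Taylor remainder; both are already multiplied by
    \<open>k N\<close>.\<close>
  have step: "cmod (k N * (ch N - 1) - T N) \<le>
      2 * C * \<bar>b\<bar> * (sqrt (k N) * g N) + \<bar>b\<bar> ^ 3 * C ^ 3 / 6 * (1 / sqrt (k N))"
    if "k N > 0" for N
  proof -
    let ?b = "b / sqrt (k N)"
    have k0: "real (k N) > 0" using that by simp
    let ?\<nu> = "distr std_normal_distribution borel (fN N)"
    have "cmod (ch N - char ?\<nu> ?b) \<le> 2 * C * \<bar>?b\<bar> * g N"
      unfolding ch_def by (rule norm_char_mono_image_diff_le[OF \<mu> real_dist_normal_dist g fN])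
    moreover have "cmod (char ?\<nu> ?b - (1 + \<i> * ?b * m1 N - ?b\<^sup>2 * m2 N / 2)) \<le> \<bar>?b\<bar> ^ 3 * C ^ 3 / 6"
      using norm_char_second_order_le[of ?\<nu> C ?b] fN(2)
      by (simp add: AE_distr_iff integral_distr m1_def m2_def)
    ultimately have "cmod ((ch N - char ?\<nu> ?b) + (char ?\<nu> ?b - (1 + \<i> * ?b * m1 N - ?b\<^sup>2 * m2 N / 2)))
        \<le> 2 * C * \<bar>?b\<bar> * g N + \<bar>?b\<bar> ^ 3 * C ^ 3 / 6"
      by (intro norm_triangle_le add_mono)
    then have "k N * cmod (ch N - (1 + \<i> * ?b * m1 N - ?b\<^sup>2 * m2 N / 2))
        \<le> k N * (2 * C * \<bar>?b\<bar> * g N + \<bar>?b\<bar> ^ 3 * C ^ 3 / 6)"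
      by (intro mult_left_mono) (simp_all add: algebra_simps)
    also have "\<dots> = 2 * C * (k N * \<bar>?b\<bar>) * g N + (k N * \<bar>?b\<bar> ^ 3) * C ^ 3 / 6"
      by (simp add: algebra_simps)
    also have "\<dots> = 2 * C * \<bar>b\<bar> * (sqrt (k N) * g N) + \<bar>b\<bar> ^ 3 * C ^ 3 / 6 * (1 / sqrt (k N))"
      unfolding mult_sqrt_powers(1,2)[OF k0] by simp
    also have "k N * cmod (ch N - (1 + \<i> * ?b * m1 N - ?b\<^sup>2 * m2 N / 2)) =
        cmod (k N * (ch N - (1 + \<i> * ?b * m1 N - ?b\<^sup>2 * m2 N / 2)))"
      by (simp add: norm_mult)
    also have "k N * (ch N - (1 + \<i> * ?b * m1 N - ?b\<^sup>2 * m2 N / 2)) =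
        k N * (ch N - 1) - (\<i> * (k N * ?b) * m1 N - (k N * ?b\<^sup>2) * m2 N / 2)"
      by (simp add: algebra_simps)
    also have "\<dots> = k N * (ch N - 1) - T N"
    proof -
      have "real (k N) * ?b = b * sqrt (k N)" "real (k N) * ?b\<^sup>2 = b\<^sup>2"
        by (rule mult_sqrt_powers[OF k0])+
      then have "complex_of_real (real (k N) * ?b) = complex_of_real (b * sqrt (k N))"
        "complex_of_real (real (k N) * ?b\<^sup>2) = complex_of_real (b\<^sup>2)" by (simp_all only:)
      then show ?thesis unfolding T_def by (simp add: mult_ac)
    qed
    finally show ?thesis .
  qed
  have "(\<lambda>N. 2 * C * \<bar>b\<bar> * (sqrt (k N) * g N) + \<bar>b\<bar> ^ 3 * C ^ 3 / 6 * (1 / sqrt (k N)))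
      \<longlonglongrightarrow> 2 * C * \<bar>b\<bar> * 0 + \<bar>b\<bar> ^ 3 * C ^ 3 / 6 * 0"
    using filterlim_inverse_sqrt_at_0[OF k] g_lim
    by (intro tendsto_add tendsto_mult_left) (simp_all add: filterlim_at)
  then have bound0: "(\<lambda>N. 2 * C * \<bar>b\<bar> * (sqrt (k N) * g N) + \<bar>b\<bar> ^ 3 * C ^ 3 / 6 * (1 / sqrt (k N))) \<longlonglongrightarrow> 0"
    by simp
  have diff: "(\<lambda>N. k N * (ch N - 1) - T N) \<longlonglongrightarrow> 0"
    by (rule Lim_null_comparison[OF _ bound0]) (rule eventually_mono[OF pos], rule step)
  have "T \<longlonglongrightarrow> \<i> * b * complex_of_real (- (t * c)) - b\<^sup>2 * V / 2"
    unfolding T_def m1_def m2_def fN_def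
    using score_shift_moments[OF k]
    by (intro tendsto_diff tendsto_mult_left tendsto_divide tendsto_const tendsto_of_real) simp_all
  from tendsto_add[OF diff this] show ?thesis
    by (simp add: ch_def fN_def[abs_def] mult_ac)
qed

text \<open>The normalisation uses the uncentred second moment \<open>V\<close>: the mean of one
  summand tends to 0, so its square does not affect the limiting variance. At scale sqrt k the mean
  does survive, as the drift - t c, which the added \<open>t * c\<close> compensates.\<close>

lemma score_clt:
  fixes k :: "nat \<Rightarrow> nat" and M :: "nat \<Rightarrow> 'w measure" and Y :: "nat \<Rightarrow> nat \<Rightarrow> 'w \<Rightarrow> real"
  assumes k: "filterlim k at_top sequentially"
    and \<mu>: "\<And>N. real_distribution (\<mu> N)"
    and g: "\<And>N u. \<bar>cdf (\<mu> N) u - cdf std_normal_distribution u\<bar> \<le> g N"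
    and g_lim: "(\<lambda>N. sqrt (k N) * g N) \<longlonglongrightarrow> 0"
    and M: "\<And>N. prob_space (M N)"
    and ind: "\<And>N. prob_space.indep_vars (M N) (\<lambda>_. borel) (Y N) {1..k N}"
    and law: "\<And>N j. j \<in> {1..k N} \<Longrightarrow> distr (M N) borel (Y N j) = \<mu> N"
    and V: "V > 0"
  shows "weak_conv_m
    (\<lambda>N. distr (M N) borel
      (\<lambda>\<omega>. ((\<Sum>j=1..k N. f (Y N j \<omega> - t / sqrt (k N))) / sqrt (k N) + t * c) / sqrt V))
    std_normal_distribution"
proof (rule levy_continuity)
  have Y [measurable]: "Y N j \<in> borel_measurable (M N)" if "j \<in> {1..k N}" for N j
    using ind[of N] that by (simp add: prob_space.indep_vars_def[OF M])
  show "real_distribution (distr (M N) borel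
      (\<lambda>\<omega>. ((\<Sum>j=1..k N. f (Y N j \<omega> - t / sqrt (k N))) / sqrt (k N) + t * c) / sqrt V))" for N
    using M by (intro prob_space.real_distribution_distr) measurable
  show "real_distribution std_normal_distribution" by (rule real_dist_normal_dist)
  fix s
  define b where "b = s / sqrt V"
  define \<nu> where "\<nu> N = distr (\<mu> N) borel (\<lambda>y. f (y - t / sqrt (k N)))" for N
  define w where "w = - (\<i> * b * t * c) - b\<^sup>2 * V / 2"
  have \<nu>: "real_distribution (\<nu> N)" for N
  proof -
    interpret real_distribution "\<mu> N" by (rule \<mu>)
    show ?thesis unfolding \<nu>_def by (rule real_distribution_distr) measurable
  qed
  have "(\<lambda>N. (1 + (char (\<nu> N) (b / sqrt (k N)) - 1)) ^ k N) \<longlonglongrightarrow> exp w"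
  proof (rule tendsto_one_plus_power_exp[OF k])
    show "(\<lambda>N. of_nat (k N) * (char (\<nu> N) (b / sqrt (k N)) - 1)) \<longlonglongrightarrow> w"
      using score_char_limit[OF k \<mu> g g_lim, of b] by (simp add: \<nu>_def w_def)
    show "cmod (1 + (char (\<nu> N) (b / sqrt (k N)) - 1)) \<le> 1" for N
      using real_distribution.cmod_char_le_1[OF \<nu>] by simp
    have "0 \<le> b\<^sup>2 * V" using V by simp
    then show "Re w \<le> 0" by (simp add: w_def)
  qed
  then have "(\<lambda>N. iexp (s * (t * c) / sqrt V) * char (\<nu> N) (b / sqrt (k N)) ^ k N) \<longlonglongrightarrow>
      iexp (s * (t * c) / sqrt V) * exp w"
    by (intro tendsto_mult_left) simp
  also have "iexp (s * (t * c) / sqrt V) * exp w = char std_normal_distribution s"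
  proof -
    \<comment> \<open>The phase cancels the imaginary part of \<open>w\<close>, leaving the Gaussian
      exponent.\<close>
    have "b\<^sup>2 * V = s\<^sup>2" using V by (simp add: b_def power_divide)
    then have "\<i> * complex_of_real (s * (t * c) / sqrt V) + w = complex_of_real (- s\<^sup>2 / 2)"
      by (simp add: w_def b_def mult_ac flip: of_real_power of_real_mult)
    then show ?thesis
      by (simp only: char_std_normal_distribution exp_of_real flip: exp_add)
  qed
  also have "(\<lambda>N. iexp (s * (t * c) / sqrt V) * char (\<nu> N) (b / sqrt (k N)) ^ k N) =
    (\<lambda>N. char (distr (M N) borel
      (\<lambda>\<omega>. ((\<Sum>j=1..k N. f (Y N j \<omega> - t / sqrt (k N))) / sqrt (k N) + t * c) / sqrt V)) s)"
  proof
    fix N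
    have "prob_space.indep_vars (M N) (\<lambda>_. borel) (\<lambda>j \<omega>. f (Y N j \<omega> - t / sqrt (k N))) {1..k N}"
      by (rule prob_space.indep_vars_compose2[OF M ind]) measurable
    moreover have "distr (M N) borel (\<lambda>\<omega>. f (Y N j \<omega> - t / sqrt (k N))) = \<nu> N" if "j \<in> {1..k N}" for j
      unfolding \<nu>_def law[OF that, symmetric] using that by (subst distr_distr) (auto simp: o_def)
    ultimately show "iexp (s * (t * c) / sqrt V) * char (\<nu> N) (b / sqrt (k N)) ^ k N =
      char (distr (M N) borel
        (\<lambda>\<omega>. ((\<Sum>j=1..k N. f (Y N j \<omega> - t / sqrt (k N))) / sqrt (k N) + t * c) / sqrt V)) s"
      using char_distr_affine_sum[OF M, of N "\<lambda>j \<omega>. f (Y N j \<omega> - t / sqrt (k N))" "{1..k N}" "\<nu> N"]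
      by (simp add: b_def)
  qed
  finally show "(\<lambda>N. char (distr (M N) borel
      (\<lambda>\<omega>. ((\<Sum>j=1..k N. f (Y N j \<omega> - t / sqrt (k N))) / sqrt (k N) + t * c) / sqrt V)) s)
    \<longlonglongrightarrow> char std_normal_distribution s" .
qed

end

section \<open>From score sums to the distribution function of the minimizer\<close>

lemma isCont_cdf_std_normal: "isCont (cdf std_normal_distribution) x"
proof -
  interpret Z: real_distribution std_normal_distribution by (rule real_dist_normal_dist)
  have "emeasure std_normal_distribution {x} = 0"
    by (subst emeasure_density) (auto simp: nn_integral_null_set)
  then show ?thesis by (simp add: Z.isCont_cdf measure_def)
qed

lemma cdf_normal_zero_mean:
  assumes "s > 0"
  shows "cdf (density lborel (normal_density 0 s)) x = cdf std_normal_distribution (x / s)"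
proof -
  interpret Z: real_distribution std_normal_distribution by (rule real_dist_normal_dist)
  have "distributed std_normal_distribution lborel (\<lambda>x. x) std_normal_density"
    by (auto simp: distributed_def distr_id2 intro!: distr_id2[where N=lborel])
  then have "distributed std_normal_distribution lborel (\<lambda>x. 0 + s * x) (normal_density (0 + s * 0) (\<bar>s\<bar> * 1))"
    using assms by (intro Z.normal_density_affine) auto
  then have "density lborel (normal_density 0 s) = distr std_normal_distribution lborel (\<lambda>x. s * x)"
    using assms by (simp add: distributed_distr_eq_density)
  also have "\<dots> = distr std_normal_distribution borel (\<lambda>x. s * x)"
    by (rule distr_cong) auto
  finally show ?thesis
    using assms by (simp add: cdf_def measure_distr vimage_def pos_le_divide_eq mult.commute atMost_def)
qed

text \<open>Both kinds of half-line are needed, since the score enters through a strict and a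
  non-strict inequality. The limits agree because the normal law has no atoms.\<close>

lemma weak_conv_std_normal_half_lines:
  assumes "\<And>N. real_distribution (\<mu> N)" and w: "weak_conv_m \<mu> std_normal_distribution"
  shows "(\<lambda>N. measure (\<mu> N) {..x}) \<longlonglongrightarrow> cdf std_normal_distribution x"
    and "(\<lambda>N. measure (\<mu> N) {..<x}) \<longlonglongrightarrow> cdf std_normal_distribution x"
proof -
  interpret Z: real_distribution std_normal_distribution by (rule real_dist_normal_dist)
  have 0: "measure std_normal_distribution {x} = 0"
    using isCont_cdf_std_normal Z.isCont_cdf by blast
  then have e0: "emeasure std_normal_distribution {x} = 0"
    by (simp add: Z.emeasure_eq_measure)
  note conv = weak_conv_imp_continuity_set_conv[OF assms(1) real_dist_normal_dist w]
  show "(\<lambda>N. measure (\<mu> N) {..x}) \<longlonglongrightarrow> cdf std_normal_distribution x"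
    unfolding cdf_def by (rule conv) (simp_all add: e0)
  have "(\<lambda>N. measure (\<mu> N) {..<x}) \<longlonglongrightarrow> measure std_normal_distribution {..<x}"
    by (rule conv) (simp_all add: e0)
  also have "measure std_normal_distribution {..<x} = cdf std_normal_distribution x"
  proof -
    have "{..x} = {..<x} \<union> {x}" by auto
    then have "measure std_normal_distribution {..x} = measure std_normal_distribution {..<x} + measure std_normal_distribution {x}"
      by (simp only:, intro Z.finite_measure_Union) auto
    with 0 show ?thesis by (simp add: cdf_def)
  qed
  finally show "(\<lambda>N. measure (\<mu> N) {..<x}) \<longlonglongrightarrow> cdf std_normal_distribution x" .
qed

lemma cdf_estimator_law_diff_le:
  assumes P: "prob_space P" and est: "est n \<in> borel_measurable (PiM {..<n} (\<lambda>_. P))"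
  shows "real_distribution (distr (estimator_law P est n) borel (\<lambda>y. (y - \<theta>) / \<sigma> n))"
    and "\<bar>cdf (distr (estimator_law P est n) borel (\<lambda>y. (y - \<theta>) / \<sigma> n)) u
      - cdf std_normal_distribution u\<bar> \<le> normal_approx_error P est \<theta> \<sigma> n"
proof -
  let ?Q = "PiM {..<n} (\<lambda>_. P)"
  let ?F = "\<lambda>t. measure ?Q {x \<in> space ?Q. (est n x - \<theta>) / \<sigma> n \<le> t}"
  interpret Q: prob_space ?Q using P by (intro prob_space_PiM)
  interpret Z: real_distribution std_normal_distribution by (rule real_dist_normal_dist)
  have [measurable]: "est n \<in> borel_measurable ?Q" by fact
  have eq: "distr (estimator_law P est n) borel (\<lambda>y. (y - \<theta>) / \<sigma> n) =
      distr ?Q borel (\<lambda>x. (est n x - \<theta>) / \<sigma> n)"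
    unfolding estimator_law_def by (subst distr_distr) (auto simp: o_def)
  show "real_distribution (distr (estimator_law P est n) borel (\<lambda>y. (y - \<theta>) / \<sigma> n))"
    unfolding eq by (rule Q.real_distribution_distr) measurable
  \<comment> \<open>A real supremum dominates its terms only if they are bounded above; differences
    of probabilities are at most 1.\<close>
  have "\<bar>?F t - cdf std_normal_distribution t\<bar> \<le> 1" for t
  proof -
    have "0 \<le> ?F t" "?F t \<le> 1" by simp_all
    with Z.cdf_nonneg[of t] Z.cdf_bounded_prob[of t] show ?thesis by linarith
  qed
  then have "bdd_above (range (\<lambda>t. \<bar>?F t - cdf std_normal_distribution t\<bar>))"
    by (intro bdd_aboveI) auto
  from cSUP_upper[OF UNIV_I this, of u]
  show "\<bar>cdf (distr (estimator_law P est n) borel (\<lambda>y. (y - \<theta>) / \<sigma> n)) u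
      - cdf std_normal_distribution u\<bar> \<le> normal_approx_error P est \<theta> \<sigma> n"
    unfolding eq normal_approx_error_def
    by (simp add: cdf_def measure_distr vimage_def Int_def conj_commute)
qed

theorem theorem3:
  fixes P :: "'x measure"
    and M :: "nat \<Rightarrow> 'w measure"
    and X :: "nat \<Rightarrow> nat \<Rightarrow> 'w \<Rightarrow> 'x"
    and G :: "nat \<Rightarrow> nat \<Rightarrow> 'w \<Rightarrow> nat set"
    and k :: "nat \<Rightarrow> nat"
    and est :: "nat \<Rightarrow> (nat \<Rightarrow> 'x) \<Rightarrow> real"
    and \<theta> :: real
    and \<sigma> :: "nat \<Rightarrow> real"
    and \<rho> :: "real \<Rightarrow> real"
    and \<theta>hat :: "nat \<Rightarrow> 'w \<Rightarrow> real"
  assumes "prob_space P"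
    and "\<And>N. prob_space (M N)"
    and X_indep: "\<And>N. prob_space.indep_vars (M N) (\<lambda>_. P) (X N) {1..N}"
    and X_law: "\<And>N i. i \<in> {1..N} \<Longrightarrow> distr (M N) P (X N i) = P"
    and G_card: "\<And>N j \<omega>. \<omega> \<in> space (M N) \<Longrightarrow> j \<in> {1..k N} \<Longrightarrow>
        G N j \<omega> \<subseteq> {1..N} \<and> card (G N j \<omega>) = N div k N"
    and G_disjoint: "\<And>N \<omega>. \<omega> \<in> space (M N) \<Longrightarrow>
        disjoint_family_on (\<lambda>j. G N j \<omega>) {1..k N}"
    and G_indep: "\<And>N. indep_rv (M N)
        (PiM {1..N} (\<lambda>_. P)) (\<lambda>\<omega>. \<lambda>i\<in>{1..N}. X N i \<omega>)
        (PiM {1..k N} (\<lambda>_. count_space (Pow {1..N}))) (\<lambda>\<omega>. \<lambda>j\<in>{1..k N}. G N j \<omega>)"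
    and est_measurable: "\<And>n. est n \<in> borel_measurable (PiM {..<n} (\<lambda>_. P))"
    and \<sigma>_pos: "\<And>n. \<sigma> n > 0"
    and normal_approx: "normal_approx_error P est \<theta> \<sigma> \<longlonglongrightarrow> 0"
    and k_at_top: "filterlim k at_top sequentially"
    and k_rate:
      "(\<lambda>N. sqrt (real (k N)) * normal_approx_error P est \<theta> \<sigma> (N div k N)) \<longlonglongrightarrow> 0"
    and \<rho>_convex: "convex_on UNIV \<rho>"
    and \<rho>_even: "\<And>z. \<rho> (- z) = \<rho> z"
    and \<rho>_coercive: "filterlim \<rho> at_top at_infinity"
    and \<rho>_deriv_bounded: "esssup lborel (\<lambda>x. ereal \<bar>avg_deriv \<rho> x\<bar>) < \<infinity>"
    and \<theta>hat_measurable: "\<And>N. \<theta>hat N \<in> borel_measurable (M N)"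
    and \<theta>hat_argmin: "\<And>N \<omega>. \<omega> \<in> space (M N) \<Longrightarrow>
        is_arg_min
          (\<lambda>z. \<Sum>j=1..k N. \<rho> ((z - group_estimate est (X N) (G N j \<omega>) \<omega>) / \<sigma> (N div k N)))
          (\<lambda>_. True) (\<theta>hat N \<omega>)"
  shows "weak_conv_m
     (\<lambda>N. distr (M N) borel
        (\<lambda>\<omega>. sqrt (real (k N)) * ((\<theta>hat N \<omega> - \<theta>) / \<sigma> (N div k N))))
     (density lborel (normal_density 0
        (sqrt ((\<integral>x. (avg_deriv \<rho> x)\<^sup>2 \<partial>std_normal_distribution)
               / (deriv (smoothed_deriv \<rho>) 0)\<^sup>2))))"
proof -
  define \<psi> where "\<psi> = avg_deriv \<rho>"
  note convex_even = \<rho>_convex \<rho>_even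
  have \<psi>_mono: "mono \<psi>" and \<psi>_odd: "\<psi> (- x) = - \<psi> x" for x
    unfolding \<psi>_def by (rule mono_avg_deriv avg_deriv_odd; fact)+
  obtain C where \<psi>_bnd: "\<And>x. \<bar>\<psi> x\<bar> \<le> C"
    using avg_deriv_bounded[of \<rho>] convex_even \<rho>_deriv_bounded unfolding \<psi>_def by blast
  obtain a0 where \<psi>_pos0: "\<And>x. x \<ge> a0 \<Longrightarrow> \<psi> x > 0"
    using avg_deriv_eventually_pos[of \<rho>] convex_even \<rho>_coercive unfolding \<psi>_def by blast
  \<comment> \<open>The 1 makes \<open>x\<close> itself positive, so that \<psi>(x) x > 0 from
    \<open>a\<close> on.\<close>
  define a where "a = max 1 a0"
  have \<psi>_pos: "\<psi> x > 0" "x > 0" if "x \<ge> a" for x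
    using \<psi>_pos0 that by (auto simp: a_def)
  have \<psi>_meas [measurable]: "\<psi> \<in> borel_measurable borel"
    using \<psi>_mono by (rule borel_measurable_mono)
  interpret Z: real_distribution std_normal_distribution by (rule real_dist_normal_dist)
  define c where "c = (\<integral>x. \<psi> x * x \<partial>std_normal_distribution)"
  define V where "V = (\<integral>x. (\<psi> x)\<^sup>2 \<partial>std_normal_distribution)"
  have "c > 0"
    unfolding c_def
  proof (rule integral_std_normal_pos)
    have "integrable std_normal_distribution (\<lambda>x. C * x)"
      using integrable_std_normal_distribution_moment[of 1] by simp
    then show "integrable std_normal_distribution (\<lambda>x. \<psi> x * x)"
      by (rule Bochner_Integration.integrable_bound)
        (use order_trans[OF \<psi>_bnd abs_ge_self] in \<open>auto simp: abs_mult intro!: mult_right_mono\<close>)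
    have "\<psi> 0 = 0" using \<psi>_odd[of 0] by simp
    then show "\<psi> x * x \<ge> 0" for x
      using monoD[OF \<psi>_mono, of 0 x] monoD[OF \<psi>_mono, of x 0]
      by (cases "x \<ge> 0") (auto intro: mult_nonneg_nonneg mult_nonpos_nonpos)
    show "\<psi> x * x > 0" if "x \<ge> a" for x
      using \<psi>_pos[OF that] by simp
  qed
  have "V > 0"
    unfolding V_def
  proof (rule integral_std_normal_pos)
    show "integrable std_normal_distribution (\<lambda>x. (\<psi> x)\<^sup>2)"
      using power_mono[OF \<psi>_bnd abs_ge_zero, of _ 2]
      by (intro Z.integrable_const_bound[where B="C\<^sup>2"]) auto
    show "(\<psi> x)\<^sup>2 > 0" if "x \<ge> a" for x
      using \<psi>_pos[OF that] by simp
  qed simp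
  have "deriv (smoothed_deriv \<rho>) 0 = c"
    using has_derivative_std_normal_shift[OF \<psi>_meas \<psi>_bnd]
    by (intro DERIV_imp_deriv) (simp add: smoothed_deriv_def[abs_def] c_def \<psi>_def add.commute)
  \<comment> \<open>Positivity of \<open>c\<close> is used twice: the quotient is a genuine
    division, and the square root of c^2 is \<open>c\<close>.\<close>
  define \<Delta> where "\<Delta> = sqrt (V / c\<^sup>2)"
  have \<Delta>: "\<Delta> > 0" "x / \<Delta> = x * c / sqrt V" for x
    using \<open>V > 0\<close> \<open>c > 0\<close> by (simp_all add: \<Delta>_def real_sqrt_divide)

  define n where "n N = N div k N" for N
  define Y where "Y N j \<omega> = (group_estimate est (X N) (G N j \<omega>) \<omega> - \<theta>) / \<sigma> (n N)" for N j \<omega>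
  define \<mu> where "\<mu> N = distr (estimator_law P est (n N)) borel (\<lambda>y. (y - \<theta>) / \<sigma> (n N))" for N
  define W where "W t N \<omega> = ((\<Sum>j=1..k N. \<psi> (Y N j \<omega> - t / sqrt (k N))) / sqrt (k N) + t * c) / sqrt V"
    for t N \<omega>
  define T where "T N \<omega> = sqrt (real (k N)) * ((\<theta>hat N \<omega> - \<theta>) / \<sigma> (n N))" for N \<omega>
  have Y: "prob_space.indep_vars (M N) (\<lambda>_. borel) (Y N) {1..k N}"
    "j \<in> {1..k N} \<Longrightarrow> distr (M N) borel (Y N j) = \<mu> N" for N j
  proof -
    interpret prob_space "M N" by fact
    have "indep_vars (\<lambda>_. borel) (\<lambda>j \<omega>. group_estimate est (X N) (G N j \<omega>) \<omega>) {1..k N} \<and>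
      (\<forall>j\<in>{1..k N}. distr (M N) borel (\<lambda>\<omega>. group_estimate est (X N) (G N j \<omega>) \<omega>) = estimator_law P est (n N))"
    \<comment> \<open>For finitely many N there may be no groups at all; independence is then
      trivial and the claim on laws vacuous.\<close>
    proof (cases "k N = 0")
      case True
      then show ?thesis by (simp add: indep_vars_def indep_sets_def)
    next
      case False
      have Gn: "G N j \<omega> \<subseteq> {1..N} \<and> card (G N j \<omega>) = n N" if "\<omega> \<in> space (M N)" "j \<in> {1..k N}" for j \<omega>
        using G_card that by (simp add: n_def)
      note r = random_group_estimate[where G="G N" and est=est, OF \<open>prob_space P\<close> X_indep[of N] X_law finite_atLeastAtMost
          finite_atLeastAtMost _ Gn G_disjoint G_indep est_measurable]
      show ?thesis using r False by simp
    qed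
    then have ind: "indep_vars (\<lambda>_. borel) (\<lambda>j \<omega>. group_estimate est (X N) (G N j \<omega>) \<omega>) {1..k N}"
      and law: "\<And>j. j \<in> {1..k N} \<Longrightarrow>
        distr (M N) borel (\<lambda>\<omega>. group_estimate est (X N) (G N j \<omega>) \<omega>) = estimator_law P est (n N)"
      by auto
    from ind show "indep_vars (\<lambda>_. borel) (Y N) {1..k N}"
      unfolding Y_def[abs_def] by (rule indep_vars_compose2) measurable
    show "distr (M N) borel (Y N j) = \<mu> N" if j: "j \<in> {1..k N}"
    proof -
      have "random_variable borel (\<lambda>\<omega>. group_estimate est (X N) (G N j \<omega>) \<omega>)"
        using ind j by (simp add: indep_vars_def)
      then show ?thesis
        unfolding \<mu>_def law[OF j, symmetric] Y_def[abs_def] by (subst distr_distr) (auto simp: o_def)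
    qed
  qed
  have T_meas [measurable]: "T N \<in> borel_measurable (M N)" for N
    unfolding T_def[abs_def] using \<theta>hat_measurable[of N] by measurable
  have Y_meas [measurable]: "Y N j \<in> borel_measurable (M N)" if "j \<in> {1..k N}" for N j
    using Y(1)[of N] that by (simp add: prob_space.indep_vars_def[OF assms(2)])
  have W_meas [measurable]: "W t N \<in> borel_measurable (M N)" for t N
    unfolding W_def[abs_def] by measurable
  have Wc: "weak_conv_m (\<lambda>N. distr (M N) borel (W t N)) std_normal_distribution" for t
    unfolding W_def[abs_def] c_def V_def
    using cdf_estimator_law_diff_le[where est=est, OF assms(1) est_measurable]
    by (intro score_clt[OF \<psi>_mono \<psi>_bnd \<psi>_odd k_at_top, where \<mu>=\<mu>
          and g="\<lambda>N. normal_approx_error P est \<theta> \<sigma> (n N)"])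
       (use k_rate Y assms(2) \<open>V > 0\<close> in \<open>simp_all add: \<mu>_def n_def V_def\<close>)
  have W_lim: "(\<lambda>N. measure (M N) {\<omega> \<in> space (M N). W t N \<omega> < t * c / sqrt V}) \<longlonglongrightarrow>
      cdf std_normal_distribution (t / \<Delta>)"
    "(\<lambda>N. measure (M N) {\<omega> \<in> space (M N). W t N \<omega> \<le> t * c / sqrt V}) \<longlonglongrightarrow>
      cdf std_normal_distribution (t / \<Delta>)" for t
    using weak_conv_std_normal_half_lines[OF prob_space.real_distribution_distr[OF assms(2) W_meas] Wc[of t],
        of "t * c / sqrt V"]
    by (simp_all add: measure_distr vimage_def Int_def conj_commute \<Delta>(2))
  have pos: "\<forall>\<^sub>F N in sequentially. k N > 0"
    using eventually_compose_filterlim[OF eventually_gt_at_top k_at_top] .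

  have T_W: "W t N \<omega> < t * c / sqrt V \<Longrightarrow> T N \<omega> \<le> t" "T N \<omega> < t \<Longrightarrow> W t N \<omega> \<le> t * c / sqrt V"
    if "k N > 0" and \<omega>: "\<omega> \<in> space (M N)" for t N \<omega>
  proof -
    \<comment> \<open>\<open>?w\<close> is the point whose rescaled deviation from \<theta> is
      exactly \<open>t\<close>. Comparing the minimizer with \<open>?w\<close> thus compares
      \<open>T\<close> with \<open>t\<close>, and the score sum at \<open>?w\<close> vanishes
      exactly when \<open>W\<close> equals \<open>t * c / sqrt V\<close>.\<close>
    let ?w = "\<theta> + \<sigma> (n N) * t / sqrt (k N)"
    let ?S = "\<Sum>j=1..k N. \<psi> (Y N j \<omega> - t / sqrt (k N))"
    have k0: "sqrt (k N) > 0" using that by simp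
    have "(group_estimate est (X N) (G N j \<omega>) \<omega> - ?w) / \<sigma> (n N) = Y N j \<omega> - t / sqrt (k N)" for j
      using \<sigma>_pos[of "n N"] k0 by (simp add: Y_def field_simps)
    then have bounds: "?S < 0 \<Longrightarrow> \<theta>hat N \<omega> \<le> ?w" "\<theta>hat N \<omega> < ?w \<Longrightarrow> ?S \<le> 0"
      using arg_min_score_bounds[OF convex_even \<sigma>_pos \<theta>hat_argmin[OF \<omega>], of ?w]
      by (simp_all add: \<psi>_def n_def)
    have "T N \<omega> \<le> t \<longleftrightarrow> \<theta>hat N \<omega> \<le> ?w" "T N \<omega> < t \<longleftrightarrow> \<theta>hat N \<omega> < ?w"
      using \<sigma>_pos[of "n N"] k0 by (simp_all add: T_def field_simps)
    moreover have "W t N \<omega> < t * c / sqrt V \<longleftrightarrow> ?S < 0" "W t N \<omega> \<le> t * c / sqrt V \<longleftrightarrow> ?S \<le> 0"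
      using \<open>V > 0\<close> k0 by (simp_all add: W_def divide_less_cancel divide_le_cancel divide_less_0_iff divide_le_0_iff)
    ultimately show "W t N \<omega> < t * c / sqrt V \<Longrightarrow> T N \<omega> \<le> t" "T N \<omega> < t \<Longrightarrow> W t N \<omega> \<le> t * c / sqrt V"
      using bounds by auto
  qed
  have lim: "(\<lambda>N. measure (M N) {\<omega> \<in> space (M N). T N \<omega> \<le> t}) \<longlonglongrightarrow> cdf std_normal_distribution (t / \<Delta>)" for t
  proof (rule order_tendstoI)
    fix y assume "y < cdf std_normal_distribution (t / \<Delta>)"
    then have "\<forall>\<^sub>F N in sequentially. y < measure (M N) {\<omega> \<in> space (M N). W t N \<omega> < t * c / sqrt V}"
      using W_lim(1) by (rule order_tendstoD(1)[rotated])
    with pos show "\<forall>\<^sub>F N in sequentially. y < measure (M N) {\<omega> \<in> space (M N). T N \<omega> \<le> t}"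
    proof eventually_elim
      case (elim N)
      interpret prob_space "M N" by fact
      have "prob {\<omega> \<in> space (M N). W t N \<omega> < t * c / sqrt V} \<le> prob {\<omega> \<in> space (M N). T N \<omega> \<le> t}"
        using T_W(1) elim by (intro finite_measure_mono) auto
      with elim show ?case by simp
    qed
  next
    \<comment> \<open>From T \<le> t no sign of the score at \<open>t\<close> follows, since only T
      < t would give one. The upper bound is therefore taken at some s > t, where T < s holds, with
      s so close to \<open>t\<close> that continuity keeps the limit below \<open>y\<close>.\<close>
    fix y assume y: "cdf std_normal_distribution (t / \<Delta>) < y"
    have "isCont (\<lambda>s. cdf std_normal_distribution (s / \<Delta>)) t"
      using \<Delta>(1) by (intro isCont_o2[OF _ isCont_cdf_std_normal]) simp
    then have "((\<lambda>s. cdf std_normal_distribution (s / \<Delta>)) \<longlongrightarrow> cdf std_normal_distribution (t / \<Delta>)) (at_right t)"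
      by (simp add: isCont_def filterlim_at_split)
    then have "\<forall>\<^sub>F s in at_right t. cdf std_normal_distribution (s / \<Delta>) < y \<and> t < s"
      using y by (intro eventually_conj order_tendstoD(2) eventually_at_right_less)
    then obtain s where s: "cdf std_normal_distribution (s / \<Delta>) < y" "t < s"
      using eventually_happens'[OF trivial_limit_at_right_real] by blast
    then have "\<forall>\<^sub>F N in sequentially. measure (M N) {\<omega> \<in> space (M N). W s N \<omega> \<le> s * c / sqrt V} < y"
      using W_lim(2) by (intro order_tendstoD(2))
    with pos show "\<forall>\<^sub>F N in sequentially. measure (M N) {\<omega> \<in> space (M N). T N \<omega> \<le> t} < y"
    proof eventually_elim
      case (elim N)
      interpret prob_space "M N" by fact
      have "prob {\<omega> \<in> space (M N). T N \<omega> \<le> t} \<le> prob {\<omega> \<in> space (M N). W s N \<omega> \<le> s * c / sqrt V}"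
        using T_W(2) elim s(2) by (intro finite_measure_mono) (auto intro: le_less_trans)
      with elim show ?case by simp
    qed
  qed
  have "weak_conv_m (\<lambda>N. distr (M N) borel (T N)) (density lborel (normal_density 0 \<Delta>))"
    unfolding weak_conv_m_def weak_conv_def cdf_normal_zero_mean[OF \<Delta>(1)]
    using lim by (simp add: cdf_def measure_distr vimage_def Int_def conj_commute)
  then show ?thesis
    unfolding T_def[abs_def] n_def \<Delta>_def \<open>deriv (smoothed_deriv \<rho>) 0 = c\<close> V_def \<psi>_def .
qed

end
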